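(* Consider the two-agent investment timing game with regulator described in the context, with regulator probabilities $(q_0,q_1,q_2,q_S)$ satisfying $\min\{q_1,q_2,q_S\}>0$, $q_0=0$ and $q_1\ge q_2$. Then there exists a Markov sub-game perfect equilibrium with strategies depending on the level $y$ of the profit process $Y$ as follows: (i) If $y<Y_L$, both agents wait for the profit level to rise and reach $Y_L$. (ii) At $y=Y_L$, there is no simultaneous exercise and each agent has an equal probability of emerging as a leader, while the other becomes a follower and waits until the profit level reaches $Y_F$. (iii) If $Y_L<y<Y_1$, each agent $i\in\{1,2\}$ chooses a mixed strategy consisting of exercising the option to invest with probability $P_i(y)$. Their expected payoffs are equal, and the regulator intervenes on the settlement of positions (i.e. in case both exercise in the same round). (iv) If $Y_1\le y<Y_2$, agent one exercises his option, and agent two becomes a follower and waits until the profit level reaches $Y_F$. (v) If $Y_2\le y<Y_F$, both agents express their desire to invest immediately, and the regulator is called. If one agent is elected leader, the other one becomes follower and waits until the profit level reaches $Y_F$. (vi) If $y\ge Y_F$, both agents act as in (v), but if a follower emerges, he invests immediately after the other agent.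
   Context: Parameters: $\nu,\mu,r\in\mathbb{R}$, $\eta,\sigma>0$, $\lambda:=(\mu-r)/\sigma$, $\delta:=\eta\lambda-(\nu-r)>0$, investment cost $K>0$, $0<D_2<D_1$. On a filtered probability space with filtration $\mathbb{F}$ generated by a Brownian motion $W$, the unit profit is $dY_t=Y_t(\nu\,dt+\eta\,dW_t)$, and $\mathbb{Q}$ is the measure under which $W_t+\lambda t$ is a Brownian motion. An active agent earns cash-flow $D_1Y_t$ if alone on the market and $D_2Y_t$ if both are active, discounted at rate $r$ and valued under $\mathbb{Q}$. For $\hat y>0$ let $\tau(\hat y):=\inf\{t\ge0: Y_t\ge\hat y\}$. Put $$\beta:=\Big(\tfrac12-\tfrac{r-\delta}{\eta^2}\Big)+\sqrt{\Big(\tfrac12-\tfrac{r-\delta}{\eta^2}\Big)^2+\tfrac{2r}{\eta^2}}>1,\qquad Y_F:=\frac{\delta K\beta}{D_2(\beta-1)}.$$ Values at level $y>0$: follower $F(y)=\frac{K}{\beta-1}(y/Y_F)^\beta$ if $y\le Y_F$, $F(y)=\frac{D_2y}{\delta}-K$ if $y>Y_F$ (the follower optimally invests at $\tau(Y_F)$); leader $L(y)=\frac{D_1y}{\delta}-\frac{D_1-D_2}{D_2}\frac{K\beta}{\beta-1}(y/Y_F)^\beta-K$ if $y<Y_F$, $L(y)=\frac{D_2y}{\delta}-K$ if $y\ge Y_F$; simultaneous investment $S(y)=\frac{D_2y}{\delta}-K$. $Y_L$ is the unique point of $(0,Y_F)$ such that $S<L<F$ for $y<Y_L$, $S<L=F$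 at $Y_L$, $S<F<L$ on $(Y_L,Y_F)$; and $S=F=L$ for $y\ge Y_F$. Regulator: with $q_0=0$, $q_1+q_2+q_S=1$. If both agents ask to invest at the same instant with $Y_t=y$, the regulator independently draws: with probability $q_1$ agent one is leader and agent two follower (payoffs $(L,F)$); with probability $q_2$ the reverse ($(F,L)$); with probability $q_S$ both invest ($(S,S)$). Thus the expected payoffs are $S_1=q_1L+q_2F+q_SS$ and $S_2=q_2L+q_1F+q_SS$. An agent asking alone becomes leader (payoff $L$) and the other agent becomes follower (payoff $F$). Agents maximize expected payoffs. Strategies: agent $i$ chooses a pair $(G^i,p^i)$ of $\mathbb{F}$-adapted processes with values in $[0,1]$, $G^i_t=\mathbf 1_{\{t\ge\tau(\hat y_i)\}}$ for some threshold $\hat y_i$ (cumulative probability of having exercised), used when the agent does not exercise immediately, and $p^i_t=p^i(Y_t)$, the probability of exercising in each round of the following coordination game. At a frozen time $t$ with $Y_t=y$, when no agent has yet invested, the agents play rounds $k=1,2,\dots$; in each round agent $i$ exercises with probability $p_i$, independently; (exercise, exercise) gives $(S_1,S_2)$; (exercise, defer) gives $(L,F)$; (defer, exercise) gives $(F,L)$; (defer, defer) means the round is repeated. It is required that $\max(p_1,p_2)>0$, so the game ends almost surely. At $y=Y_L$, where $P_1(Y_L)=P_2(Y_L)=0$, the probabilities that agent one is sole first mover, agent two is sole first mover, or both move simultaneously, are understood as the limits as $y\downarrow Y_L$ of those induced by $(P_1(y),P_2(y))$. For $y\in[Y_L,Y_F)$: $p_0(y):=\frac{L(y)-F(y)}{L(y)-S(y)}$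 and $P_i(y):=\frac{p_0(y)}{q_ip_0(y)+q_S}$, $i=1,2$. $Y_1,Y_2\in(Y_L,Y_F)$ are the points with $S_1(Y_1)=F(Y_1)$ and $S_2(Y_2)=F(Y_2)$ (so $Y_1\le Y_2$, with equality when $q_1=q_2$). *)

theory Defs
  imports "HOL-Probability.Probability"
begin

section \<open>Brownian motion\<close>

definition generated_filtration :: "'a set \<Rightarrow> (real \<Rightarrow> 'a \<Rightarrow> real) \<Rightarrow> real \<Rightarrow> 'a measure" where
  "generated_filtration \<Omega> W t =
     sigma \<Omega> {W s -` A \<inter> \<Omega> | s A. 0 \<le> s \<and> s \<le> t \<and> A \<in> sets borel}"

text \<open>Standard Brownian motion on [0, \<infinity>), with respect to the filtration it generates.
  Negative times are irrelevant. Every path is continuous, so that first hitting times of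
  closed sets are stopping times of the generated filtration without augmenting it.\<close>

definition brownian_motion :: "'a measure \<Rightarrow> (real \<Rightarrow> 'a \<Rightarrow> real) \<Rightarrow> bool" where
  "brownian_motion M B \<longleftrightarrow>
     prob_space M \<and>
     (\<forall>t\<ge>0. B t \<in> borel_measurable M) \<and>
     (\<forall>\<omega>\<in>space M. B 0 \<omega> = 0 \<and> continuous_on {0..} (\<lambda>t. B t \<omega>)) \<and>
     (\<forall>s t. 0 \<le> s \<and> s < t \<longrightarrow>
        distributed M lborel (\<lambda>\<omega>. B t \<omega> - B s \<omega>) (normal_density 0 (sqrt (t - s))) \<and>
        prob_space.indep_set M
          (sets (generated_filtration (space M) B s))
          {(\<lambda>\<omega>. B t \<omega> - B s \<omega>) -` A \<inter> space M | A. A \<in> sets borel})"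

definition adapted :: "(real \<Rightarrow> 'a measure) \<Rightarrow> (real \<Rightarrow> 'a \<Rightarrow> real) \<Rightarrow> bool" where
  "adapted F X \<longleftrightarrow> (\<forall>t\<ge>0. X t \<in> borel_measurable (F t))"


section \<open>The market\<close>

datatype agent = Agent1 | Agent2

primrec other :: "agent \<Rightarrow> agent" where
  "other Agent1 = Agent2"
| "other Agent2 = Agent1"

text \<open>\<open>physical\<close>, \<open>pricing\<close> and \<open>noise\<close> are the measures P and Q and the P-Brownian motion W.
  \<open>qlead i\<close> is the probability that the regulator elects agent \<open>i\<close> as leader, \<open>qjoint\<close> the
  probability that it lets both agents invest.\<close>

record 'a model =
  nu :: real
  mu :: real
  rate :: real
  eta :: real
  sigma :: real
  cost :: real
  D1 :: real
  D2 :: real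
  qlead :: "agent \<Rightarrow> real"
  qjoint :: real
  physical :: "'a measure"
  pricing :: "'a measure"
  noise :: "real \<Rightarrow> 'a \<Rightarrow> real"

definition price_of_risk :: "'a model \<Rightarrow> real" where
  "price_of_risk m = (mu m - rate m) / sigma m"

definition delta :: "'a model \<Rightarrow> real" where
  "delta m = eta m * price_of_risk m - (nu m - rate m)"

definition beta :: "'a model \<Rightarrow> real" where
  "beta m = (1/2 - (rate m - delta m) / (eta m)\<^sup>2)
     + sqrt ((1/2 - (rate m - delta m) / (eta m)\<^sup>2)\<^sup>2 + 2 * rate m / (eta m)\<^sup>2)"

text \<open>The profit process started at level \<open>y\<close>: the explicit solution of
  dY = Y (nu dt + eta dW), Y(0) = y.\<close>

definition profit :: "'a model \<Rightarrow> real \<Rightarrow> real \<Rightarrow> 'a \<Rightarrow> real" where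
  "profit m y t \<omega> = y * exp ((nu m - (eta m)\<^sup>2 / 2) * t + eta m * noise m t \<omega>)"

text \<open>The time \<open>\<tau>(c)\<close> for the profit process started at level \<open>y\<close>; it is \<open>\<infinity>\<close> if \<open>c\<close> is
  never reached.\<close>

definition hit :: "'a model \<Rightarrow> real \<Rightarrow> real \<Rightarrow> 'a \<Rightarrow> ereal" where
  "hit m y c \<omega> = (INF t\<in>{t. 0 \<le> t \<and> c \<le> profit m y t \<omega>}. ereal t)"

definition discount :: "'a model \<Rightarrow> ereal \<Rightarrow> real" where
  "discount m T = (if T = \<infinity> then 0 else exp (- rate m * real_of_ereal T))"


section \<open>Value functions and thresholds\<close>

definition YF :: "'a model \<Rightarrow> real" where
  "YF m = delta m * cost m * beta m / (D2 m * (beta m - 1))"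

definition follower_value :: "'a model \<Rightarrow> real \<Rightarrow> real" where
  "follower_value m y =
     (if y \<le> YF m then cost m / (beta m - 1) * (y / YF m) powr beta m
      else D2 m * y / delta m - cost m)"

definition leader_value :: "'a model \<Rightarrow> real \<Rightarrow> real" where
  "leader_value m y =
     (if y < YF m
      then D1 m * y / delta m
           - (D1 m - D2 m) / D2 m * (cost m * beta m / (beta m - 1)) * (y / YF m) powr beta m
           - cost m
      else D2 m * y / delta m - cost m)"

definition joint_value :: "'a model \<Rightarrow> real \<Rightarrow> real" where
  "joint_value m y = D2 m * y / delta m - cost m"

text \<open>Expected payoff of agent \<open>i\<close> under the regulator's draw, when a leader receives \<open>l\<close>,
  a follower \<open>f\<close>, and an agent investing jointly with the other one \<open>j\<close>.\<close>

definition regulated :: "'a model \<Rightarrow> agent \<Rightarrow> real \<Rightarrow> real \<Rightarrow> real \<Rightarrow> real" where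
  "regulated m i l f j = qlead m i * l + qlead m (other i) * f + qjoint m * j"

definition regulated_value :: "'a model \<Rightarrow> agent \<Rightarrow> real \<Rightarrow> real" where
  "regulated_value m i y = regulated m i (leader_value m y) (follower_value m y) (joint_value m y)"

definition is_YL :: "'a model \<Rightarrow> real \<Rightarrow> bool" where
  "is_YL m x \<longleftrightarrow> 0 < x \<and> x < YF m \<and>
     (\<forall>y. 0 < y \<and> y < x \<longrightarrow>
        joint_value m y < leader_value m y \<and> leader_value m y < follower_value m y) \<and>
     joint_value m x < leader_value m x \<and> leader_value m x = follower_value m x \<and>
     (\<forall>y. x < y \<and> y < YF m \<longrightarrow>
        joint_value m y < follower_value m y \<and> follower_value m y < leader_value m y)"

definition p0 :: "'a model \<Rightarrow> real \<Rightarrow> real" where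
  "p0 m y = (leader_value m y - follower_value m y) / (leader_value m y - joint_value m y)"

definition mixed_prob :: "'a model \<Rightarrow> agent \<Rightarrow> real \<Rightarrow> real" where
  "mixed_prob m i y = p0 m y / (qlead m i * p0 m y + qjoint m)"


section \<open>Strategies\<close>

text \<open>A Markov strategy. The process G is given by a threshold: \<open>wait\<close> is the threshold while
  nobody has invested, \<open>follow\<close> the one used once the other agent has become leader. The process
  p is \<open>exer\<close> evaluated along the profit process.\<close>

record strategy =
  wait :: real
  exer :: "real \<Rightarrow> real"
  follow :: real

definition G :: "'a model \<Rightarrow> real \<Rightarrow> real \<Rightarrow> real \<Rightarrow> 'a \<Rightarrow> real" where
  "G m y c t \<omega> = (if hit m y c \<omega> \<le> ereal t then 1 else 0)"

definition admissible :: "'a model \<Rightarrow> strategy \<Rightarrow> bool" where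
  "admissible m s \<longleftrightarrow>
     0 < wait s \<and> 0 < follow s \<and> (\<forall>y. 0 \<le> exer s y \<and> exer s y \<le> 1) \<and>
     (\<forall>y>0. let \<F> = generated_filtration (space (physical m)) (noise m) in
        adapted \<F> (G m y (wait s)) \<and> adapted \<F> (G m y (follow s)) \<and>
        adapted \<F> (\<lambda>t \<omega>. exer s (profit m y t \<omega>)))"


section \<open>The coordination game\<close>

text \<open>Outcome probabilities of the repeated rounds with exercise probabilities \<open>p\<close>; the \<open>k\<close>-th
  term is the probability that the first \<open>k\<close> rounds are (defer, defer) and the next one decides.\<close>

definition sole_prob :: "(agent \<Rightarrow> real) \<Rightarrow> agent \<Rightarrow> real" where
  "sole_prob p i = (\<Sum>k. ((1 - p Agent1) * (1 - p Agent2)) ^ k * (p i * (1 - p (other i))))"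

definition both_prob :: "(agent \<Rightarrow> real) \<Rightarrow> real" where
  "both_prob p = (\<Sum>k. ((1 - p Agent1) * (1 - p Agent2)) ^ k * (p Agent1 * p Agent2))"

text \<open>Outcome probabilities at level \<open>y\<close>. At a level where both exercise probabilities vanish
  they are the limits from above; \<open>ends\<close> says that the game is then resolved almost surely.\<close>

definition sole_at :: "(agent \<Rightarrow> strategy) \<Rightarrow> real \<Rightarrow> agent \<Rightarrow> real" where
  "sole_at s y i =
     (if 0 < max (exer (s Agent1) y) (exer (s Agent2) y) then sole_prob (\<lambda>j. exer (s j) y) i
      else Lim (at_right y) (\<lambda>x. sole_prob (\<lambda>j. exer (s j) x) i))"

definition both_at :: "(agent \<Rightarrow> strategy) \<Rightarrow> real \<Rightarrow> real" where
  "both_at s y =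
     (if 0 < max (exer (s Agent1) y) (exer (s Agent2) y) then both_prob (\<lambda>j. exer (s j) y)
      else Lim (at_right y) (\<lambda>x. both_prob (\<lambda>j. exer (s j) x)))"

definition ends :: "(agent \<Rightarrow> strategy) \<Rightarrow> real \<Rightarrow> bool" where
  "ends s y \<longleftrightarrow>
     0 < max (exer (s Agent1) y) (exer (s Agent2) y) \<or>
     (\<exists>a1 a2 b. ((\<lambda>x. sole_prob (\<lambda>j. exer (s j) x) Agent1) \<longlongrightarrow> a1) (at_right y) \<and>
                ((\<lambda>x. sole_prob (\<lambda>j. exer (s j) x) Agent2) \<longlongrightarrow> a2) (at_right y) \<and>
                ((\<lambda>x. both_prob (\<lambda>j. exer (s j) x)) \<longlongrightarrow> b) (at_right y) \<and>
                a1 + a2 + b = 1)"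

text \<open>Probability that agent \<open>i\<close> emerges as leader (and the other one as follower): either as
  sole first mover, or by election after a simultaneous exercise.\<close>

definition leader_prob :: "'a model \<Rightarrow> (agent \<Rightarrow> strategy) \<Rightarrow> real \<Rightarrow> agent \<Rightarrow> real" where
  "leader_prob m s y i = sole_at s y i + both_at s y * qlead m i"


section \<open>Payoffs\<close>

text \<open>Expected discounted cash-flows under the pricing measure, from the instant the positions
  are settled at level \<open>x\<close>, when the follower uses threshold \<open>z\<close>. For \<open>z = YF m\<close> these are
  the functions \<open>leader_value\<close> and \<open>follower_value\<close>; \<open>joint_payoff\<close> is \<open>joint_value\<close>.\<close>

definition leader_payoff :: "'a model \<Rightarrow> real \<Rightarrow> real \<Rightarrow> real" where
  "leader_payoff m z x =
     (LINT \<omega>|pricing m.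
        (LINT t:{0..}|lborel. exp (- rate m * t) *
           ((if ereal t < hit m x z \<omega> then D1 m else D2 m) * profit m x t \<omega>))) - cost m"

definition follower_payoff :: "'a model \<Rightarrow> real \<Rightarrow> real \<Rightarrow> real" where
  "follower_payoff m z x =
     (LINT \<omega>|pricing m.
        (LINT t:{t. 0 \<le> t \<and> hit m x z \<omega> \<le> ereal t}|lborel. exp (- rate m * t) *
           (D2 m * profit m x t \<omega>)) - discount m (hit m x z \<omega>) * cost m)"

definition joint_payoff :: "'a model \<Rightarrow> real \<Rightarrow> real" where
  "joint_payoff m x =
     (LINT \<omega>|pricing m.
        (LINT t:{0..}|lborel. exp (- rate m * t) * (D2 m * profit m x t \<omega>))) - cost m"

definition game_payoff :: "'a model \<Rightarrow> (agent \<Rightarrow> strategy) \<Rightarrow> agent \<Rightarrow> real \<Rightarrow> real" where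
  "game_payoff m s i x =
     (let l = leader_payoff m (follow (s (other i))) x;
          f = follower_payoff m (follow (s i)) x
      in sole_at s x i * l + sole_at s x (other i) * f
         + both_at s x * regulated m i l f (joint_payoff m x))"

text \<open>In the sub-game started at level \<open>y\<close> with nobody invested, the coordination game is called
  at the first time one of the processes G reaches 1.\<close>

definition call_time :: "'a model \<Rightarrow> (agent \<Rightarrow> strategy) \<Rightarrow> real \<Rightarrow> 'a \<Rightarrow> ereal" where
  "call_time m s y \<omega> = (INF t\<in>{t. 0 \<le> t \<and> (\<exists>i. G m y (wait (s i)) t \<omega> = 1)}. ereal t)"

text \<open>\<open>playable\<close> is the requirement that one exercise probability be positive whenever the
  game is called. In particular, no agent may block a called game by deferring for ever.\<close>

definition playable :: "'a model \<Rightarrow> (agent \<Rightarrow> strategy) \<Rightarrow> real \<Rightarrow> bool" where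
  "playable m s y \<longleftrightarrow>
     (\<forall>\<omega>\<in>space (pricing m). call_time m s y \<omega> \<noteq> \<infinity> \<longrightarrow>
        ends s (profit m y (real_of_ereal (call_time m s y \<omega>)) \<omega>))"

definition payoff :: "'a model \<Rightarrow> (agent \<Rightarrow> strategy) \<Rightarrow> agent \<Rightarrow> real \<Rightarrow> real" where
  "payoff m s i y =
     (LINT \<omega>|pricing m. (let T = call_time m s y \<omega> in
        discount m T * game_payoff m s i (profit m y (real_of_ereal T) \<omega>)))"


section \<open>Equilibrium\<close>

text \<open>As the profit process is a time-homogeneous Markov process and strategies depend on its
  level only, the sub-games are indexed by the current level \<open>y\<close>, with either nobody or exactly
  one agent having invested. In the first kind, unilateral deviations range over the admissible
  strategies that lead to a game that ends; in the second kind only the follower still has to act.\<close>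

definition markov_subgame_perfect :: "'a model \<Rightarrow> (agent \<Rightarrow> strategy) \<Rightarrow> bool" where
  "markov_subgame_perfect m s \<longleftrightarrow>
     (\<forall>i. admissible m (s i)) \<and>
     (\<forall>y>0. playable m s y) \<and>
     (\<forall>i. \<forall>y>0. \<forall>s'. admissible m s' \<and> playable m (s(i := s')) y \<longrightarrow>
        payoff m (s(i := s')) i y \<le> payoff m s i y) \<and>
     (\<forall>i. \<forall>y>0. \<forall>s'. admissible m s' \<longrightarrow>
        follower_payoff m (follow s') y \<le> follower_payoff m (follow (s i)) y)"

end

theory Submission
  imports Defs
begin

text \<open>All pay-offs are expected discounted values at the first time \<open>\<tau>\<close> at which the profit process
  reaches a level \<open>c\<close>. With \<open>\<beta>\<close> the larger root of the characteristic quadratic,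
  \<open>exp (- r t) (Y t / y) powr \<beta>\<close> and \<open>exp (- (r - \<delta>) t) Y t\<close> are exponential martingales, and optional
  stopping gives \<open>E (exp (- r \<tau>)) = (y / c) powr \<beta>\<close> together with the values of the leader and of
  the follower. No mass escapes on \<open>\<tau> = \<infinity>\<close>: before \<open>\<tau>\<close> the first martingale is at most a constant times
  \<open>exp (- r t) Y t\<close>, whose expectation decays like \<open>exp (- \<delta> t)\<close>.

  The game then becomes deterministic. With \<open>u = y / YF\<close>, the ratio \<open>(F - S) / (L - S)\<close> is strictly
  decreasing in \<open>y\<close> because the chord slope \<open>(1 - u powr \<beta>) / (1 - u)\<close> is strictly increasing; hence
  agent \<open>i\<close> prefers the regulated outcome to following exactly from its threshold on.
  On \<open>(YL, Y1)\<close> the exercise probabilities make the opponent indifferent, and below \<open>YL\<close> a deviator can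
  only become leader, where \<open>L < F\<close> and \<open>F\<close> is the discounted value of waiting.\<close>

section \<open>Brownian motion and optional stopping\<close>

text \<open>Optional stopping is done without conditional expectations: the martingale property is
  an equality of integrals over past events, and passing from grid times to the stopping time needs
  only an L2 bound, because the square of an exponential martingale is, up to a factor bounded on
  \<open>[0, t]\<close>, one with twice the parameter. The sign of \<open>rate m\<close> is free, so
  discount factors may exceed 1; discounted limits therefore use monotone convergence and Tonelli.
  Filtrations are not completed, so hitting events must be measurable outright, both for the
  filtration of the drifted noise (stopping) and for that of \<open>noise m\<close> (admissibility).
  In the game the delicate deviations have exercise probability 0 at the called level, where the
  outcome is a limit from above; at \<open>YL\<close> only the fact that this limit is a probability
  distribution is used. Mixing stops at \<open>Y1\<close> because \<open>mixed_prob m Agent2\<close>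
  reaches 1 exactly there; from \<open>Y1\<close> to \<open>Y2\<close> the profile is
  asymmetric.\<close>

lemma running_max_sets:
  fixes X :: "real \<Rightarrow> 'a \<Rightarrow> real"
  assumes X: "\<And>s. 0 \<le> s \<Longrightarrow> s \<le> t \<Longrightarrow> X s \<in> borel_measurable N"
    and cont: "\<And>\<omega>. \<omega> \<in> space N \<Longrightarrow> continuous_on {0..t} (\<lambda>s. X s \<omega>)"
    and t: "0 \<le> t"
  shows "{\<omega>\<in>space N. \<exists>s\<in>{0..t}. c \<le> X s \<omega>} \<in> sets N"
proof -
  obtain D where D: "countable D" "D \<subseteq> {0..t}" "{0..t} \<subseteq> closure D"
    using separable[of "{0..t}"] by blast
  have cl: "closure D = {0..t}"
    using D closure_minimal[of D "{0..t}"] by auto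
  \<comment> \<open>The margin \<open>1 / Suc n\<close> is there because a path may reach
    \<open>c\<close> only at a time outside \<open>D\<close>; the converse uses that the maximum
    over the compact interval is attained.\<close>
  have iff: "(\<exists>s\<in>{0..t}. c \<le> X s \<omega>) \<longleftrightarrow> (\<forall>n::nat. \<exists>s\<in>D. c - 1 / Suc n < X s \<omega>)"
    if w: "\<omega> \<in> space N" for \<omega>
  proof
    assume "\<exists>s\<in>{0..t}. c \<le> X s \<omega>"
    then obtain s where s: "s \<in> {0..t}" "c \<le> X s \<omega>" by blast
    show "\<forall>n::nat. \<exists>s\<in>D. c - 1 / Suc n < X s \<omega>"
    proof (rule allI, rule ccontr)
      fix n :: nat
      assume "\<not> (\<exists>s\<in>D. c - 1 / Suc n < X s \<omega>)"
      then have "\<And>s. s \<in> D \<Longrightarrow> X s \<omega> \<le> c - 1 / Suc n" by force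
      then have "X s \<omega> \<le> c - 1 / Suc n"
        using continuous_le_on_closure[of D "\<lambda>s. X s \<omega>" s "c - 1 / Suc n"] cont[OF w] cl s by auto
      moreover have "0 < 1 / real (Suc n)" by simp
      ultimately show False using s by linarith
    qed
  next
    assume *: "\<forall>n::nat. \<exists>s\<in>D. c - 1 / Suc n < X s \<omega>"
    obtain m where m: "m \<in> {0..t}" "\<And>s. s \<in> {0..t} \<Longrightarrow> X s \<omega> \<le> X m \<omega>"
      using continuous_attains_sup[of "{0..t}" "\<lambda>s. X s \<omega>"] cont[OF w] t by auto
    have "c \<le> X m \<omega>"
    proof (rule ccontr)
      assume "\<not> c \<le> X m \<omega>"
      then have "0 < c - X m \<omega>" by simp
      then obtain n where "inverse (real (Suc n)) < c - X m \<omega>" using reals_Archimedean by blast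
      moreover obtain s where "s \<in> D" "c - 1 / Suc n < X s \<omega>" using * by blast
      ultimately show False using m(2)[of s] D(2) by (auto simp: inverse_eq_divide)
    qed
    then show "\<exists>s\<in>{0..t}. c \<le> X s \<omega>" using m by blast
  qed
  have "{\<omega>\<in>space N. \<exists>s\<in>{0..t}. c \<le> X s \<omega>} =
      {\<omega>\<in>space N. \<forall>n::nat. \<exists>s\<in>D. c - 1 / Suc n < X s \<omega>}"
    using iff by auto
  also have "\<dots> \<in> sets N"
  proof -
    have "{\<omega>\<in>space N. c - 1 / Suc n < X s \<omega>} \<in> sets N" if "s \<in> D" for s and n :: nat
    proof -
      have [measurable]: "X s \<in> borel_measurable N" using X D that by auto
      show ?thesis by measurable
    qed
    then have "{\<omega>\<in>space N. \<exists>s\<in>D. c - 1 / Suc n < X s \<omega>} \<in> sets N" for n :: nat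
      by (rule sets.sets_Collect_countable_Ex'[OF _ D(1)])
    then show ?thesis by (rule sets.sets_Collect_countable_All)
  qed
  finally show ?thesis .
qed

text \<open>The L2 bound acts as uniform integrability. Fatou bounds the limit integral by
  \<open>I\<close> from above; for the reverse, truncation at \<open>R\<close> costs at most
  \<open>C / R\<close>, and dominated convergence applies to the truncated variables.\<close>

lemma square_bounded_imp_integral_tendsto:
  fixes Z :: "nat \<Rightarrow> 'a \<Rightarrow> real"
  assumes lim: "\<And>\<omega>. \<omega> \<in> space M \<Longrightarrow> (\<lambda>n. Z n \<omega>) \<longlonglongrightarrow> Z' \<omega>"
    and nonneg: "\<And>n \<omega>. 0 \<le> Z n \<omega>"
    and int: "\<And>n. integrable M (Z n)" "\<And>n. (\<integral>\<omega>. Z n \<omega> \<partial>M) = I"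
    and sq: "\<And>n. integrable M (\<lambda>\<omega>. (Z n \<omega>)\<^sup>2)" "\<And>n. (\<integral>\<omega>. (Z n \<omega>)\<^sup>2 \<partial>M) \<le> C"
    and fin: "finite_measure M"
  shows "integrable M Z'" "(\<integral>\<omega>. Z' \<omega> \<partial>M) = I"
proof -
  interpret finite_measure M by (rule fin)
  have [measurable]: "Z n \<in> borel_measurable M" for n using int(1) by auto
  have Z'm[measurable]: "Z' \<in> borel_measurable M"
    by (rule borel_measurable_LIMSEQ_real[OF lim]) auto
  have nn': "0 \<le> Z' \<omega>" if "\<omega> \<in> space M" for \<omega>
    using lim[OF that] nonneg by (meson LIMSEQ_le_const)
  have I0: "0 \<le> I" using int(2)[of 0, symmetric] nonneg by simp
  have nnZ: "(\<integral>\<^sup>+\<omega>. ennreal (Z n \<omega>) \<partial>M) = ennreal I" for n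
    using nn_integral_eq_integral[OF int(1)[of n]] nonneg int(2) by simp
  have "(\<integral>\<^sup>+\<omega>. ennreal (Z' \<omega>) \<partial>M) = (\<integral>\<^sup>+\<omega>. liminf (\<lambda>n. ennreal (Z n \<omega>)) \<partial>M)"
  proof (rule nn_integral_cong)
    fix \<omega> assume "\<omega> \<in> space M"
    then have "(\<lambda>n. ennreal (Z n \<omega>)) \<longlonglongrightarrow> ennreal (Z' \<omega>)"
      using lim tendsto_ennrealI by blast
    then show "ennreal (Z' \<omega>) = liminf (\<lambda>n. ennreal (Z n \<omega>))"
      by (simp add: lim_imp_Liminf)
  qed
  also have "\<dots> \<le> liminf (\<lambda>n. \<integral>\<^sup>+\<omega>. ennreal (Z n \<omega>) \<partial>M)"
    by (rule nn_integral_liminf) simp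
  also have "\<dots> = ennreal I" by (simp add: nnZ Liminf_const)
  finally have up: "(\<integral>\<^sup>+\<omega>. ennreal (Z' \<omega>) \<partial>M) \<le> ennreal I" .
  show iZ': "integrable M Z'"
    using up nn' by (intro integrableI_nonneg) (auto simp: le_less_trans)
  have le: "(\<integral>\<omega>. Z' \<omega> \<partial>M) \<le> I"
    using up nn_integral_eq_integral[OF iZ'] nn' I0
    by (metis (mono_tags, lifting) AE_I2 ennreal_le_iff)
  have low: "I - C / R \<le> (\<integral>\<omega>. Z' \<omega> \<partial>M)" if R: "0 < R" for R
  proof -
    have imin: "integrable M (\<lambda>\<omega>. min (Z n \<omega>) R)" for n
      using nonneg R by (intro integrable_const_bound[where B=R]) (auto simp: min_def)
    have step: "I - C / R \<le> (\<integral>\<omega>. min (Z n \<omega>) R \<partial>M)" for n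
    proof -
      \<comment> \<open>For \<open>z \<le> R\<close> the square is simply dropped; for
        \<open>z > R\<close> the left side is already at most 0. Integration gives the loss
        \<open>C / R\<close> uniformly in \<open>n\<close>.\<close>
      have p: "Z n \<omega> - (Z n \<omega>)\<^sup>2 / R \<le> min (Z n \<omega>) R" for \<omega>
      proof (cases "Z n \<omega> \<le> R")
        case True then show ?thesis using R by simp
      next
        case False
        then have "Z n \<omega> * R \<le> Z n \<omega> * Z n \<omega>" using nonneg[of n \<omega>] by (intro mult_left_mono) auto
        then have "Z n \<omega> \<le> (Z n \<omega>)\<^sup>2 / R" using R by (simp add: field_simps power2_eq_square)
        then show ?thesis using False R by simp
      qed
      have "C / R \<ge> (\<integral>\<omega>. (Z n \<omega>)\<^sup>2 \<partial>M) / R" using sq R by (intro divide_right_mono) auto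
      then have "I - C / R \<le> (\<integral>\<omega>. Z n \<omega> - (Z n \<omega>)\<^sup>2 / R \<partial>M)"
        using int sq R by (simp add: Bochner_Integration.integral_diff)
      also have "\<dots> \<le> (\<integral>\<omega>. min (Z n \<omega>) R \<partial>M)"
        using int(1) sq(1) imin p by (intro integral_mono) auto
      finally show ?thesis .
    qed
    have "(\<lambda>n. \<integral>\<omega>. min (Z n \<omega>) R \<partial>M) \<longlonglongrightarrow> (\<integral>\<omega>. min (Z' \<omega>) R \<partial>M)"
      using lim nonneg R
      by (intro integral_dominated_convergence[where w="\<lambda>_. R"])
         (auto intro!: tendsto_min AE_I2 simp del: min_less_iff_conj)
    then have "I - C / R \<le> (\<integral>\<omega>. min (Z' \<omega>) R \<partial>M)"
      using step by (meson LIMSEQ_le_const)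
    also have "\<dots> \<le> (\<integral>\<omega>. Z' \<omega> \<partial>M)"
      using iZ' by (intro integral_mono) (auto)
    finally show ?thesis .
  qed
  have "I \<le> (\<integral>\<omega>. Z' \<omega> \<partial>M)"
  proof (rule LIMSEQ_le_const2)
    show "(\<lambda>n. I - C / real (Suc n)) \<longlonglongrightarrow> I"
      by real_asymp
    show "\<exists>N. \<forall>n\<ge>N. I - C / real (Suc n) \<le> (\<integral>\<omega>. Z' \<omega> \<partial>M)"
      using low by auto
  qed
  with le show "(\<integral>\<omega>. Z' \<omega> \<partial>M) = I" by simp
qed

lemma
  fixes \<theta> v :: real
  assumes v: "0 < v"
  shows integrable_exp_normal_density:
      "integrable lborel (\<lambda>x. normal_density 0 (sqrt v) x * exp (\<theta> * x))"
    and integral_exp_normal_density: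
      "(\<integral>x. normal_density 0 (sqrt v) x * exp (\<theta> * x) \<partial>lborel) = exp (\<theta>\<^sup>2 * v / 2)"
proof -
  have eq: "normal_density 0 (sqrt v) x * exp (\<theta> * x) =
      exp (\<theta>\<^sup>2 * v / 2) * normal_density (\<theta> * v) (sqrt v) x" for x
  proof -
    have "- (x\<^sup>2) / (2 * v) + \<theta> * x = \<theta>\<^sup>2 * v / 2 - (x - \<theta> * v)\<^sup>2 / (2 * v)"
      using v by (simp add: field_simps power2_eq_square)
    then have "exp (- (x\<^sup>2) / (2 * v)) * exp (\<theta> * x) =
        exp (\<theta>\<^sup>2 * v / 2) * exp (- ((x - \<theta> * v)\<^sup>2) / (2 * v))"
      by (simp add: exp_add[symmetric])
    then show ?thesis using v by (simp add: normal_density_def)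
  qed
  show "integrable lborel (\<lambda>x. normal_density 0 (sqrt v) x * exp (\<theta> * x))"
    unfolding eq using v by (intro integrable_mult_right) auto
  show "(\<integral>x. normal_density 0 (sqrt v) x * exp (\<theta> * x) \<partial>lborel) = exp (\<theta>\<^sup>2 * v / 2)"
    unfolding eq using v by simp
qed

lemma space_generated_filtration [simp]: "space (generated_filtration \<Omega> W t) = \<Omega>"
  unfolding generated_filtration_def by (rule space_measure_of) auto

lemma measurable_generated_filtration:
  assumes "0 \<le> s" "s \<le> t"
  shows "W s \<in> borel_measurable (generated_filtration \<Omega> W t)"
proof (rule measurableI)
  fix A :: "real set" assume A: "A \<in> sets borel"
  have "W s -` A \<inter> \<Omega> \<in> sets (Sigma_Algebra.sigma \<Omega> {W s -` A \<inter> \<Omega> | s A. 0 \<le> s \<and> s \<le> t \<and> A \<in> sets borel})"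
    using A assms by (subst sets_measure_of) (auto intro!: sigma_sets.Basic)
  then show "W s -` A \<inter> space (generated_filtration \<Omega> W t) \<in> sets (generated_filtration \<Omega> W t)"
    unfolding generated_filtration_def by (simp add: space_measure_of_conv)
qed simp

lemma generated_filtration_mono:
  assumes "s \<le> t"
  shows "sets (generated_filtration \<Omega> W s) \<subseteq> sets (generated_filtration \<Omega> W t)"
proof -
  have "sigma_sets \<Omega> {W u -` A \<inter> \<Omega> | u A. 0 \<le> u \<and> u \<le> s \<and> A \<in> sets borel}
      \<subseteq> sigma_sets \<Omega> {W u -` A \<inter> \<Omega> | u A. 0 \<le> u \<and> u \<le> t \<and> A \<in> sets borel}"
    using assms by (intro sigma_sets_mono') (blast intro: order_trans)
  moreover have "{W u -` A \<inter> \<Omega> | u A. 0 \<le> u \<and> u \<le> r \<and> A \<in> sets borel} \<subseteq> Pow \<Omega>" for r by auto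
  ultimately show ?thesis unfolding generated_filtration_def by (simp add: sets_measure_of)
qed

lemma Int_stable_vimage: "Int_stable {X -` A \<inter> \<Omega> | A. A \<in> sets N}"
proof (rule Int_stableI)
  fix a b
  assume "a \<in> {X -` A \<inter> \<Omega> | A. A \<in> sets N}" "b \<in> {X -` A \<inter> \<Omega> | A. A \<in> sets N}"
  then obtain A B where "a = X -` A \<inter> \<Omega>" "b = X -` B \<inter> \<Omega>" "A \<in> sets N" "B \<in> sets N"
    by blast
  then have "a \<inter> b = X -` (A \<inter> B) \<inter> \<Omega>" "A \<inter> B \<in> sets N" by auto
  then show "a \<inter> b \<in> {X -` A \<inter> \<Omega> | A. A \<in> sets N}" by blast
qed

section \<open>Exponential martingales of Brownian motion\<close>

locale brownian =
  fixes M :: "'a measure" and B :: "real \<Rightarrow> 'a \<Rightarrow> real"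
  assumes bm: "brownian_motion M B"
begin

sublocale prob_space M using bm unfolding brownian_motion_def by blast

abbreviation \<F> :: "real \<Rightarrow> 'a measure" where "\<F> \<equiv> generated_filtration (space M) B"

definition exp_mart :: "real \<Rightarrow> real \<Rightarrow> 'a \<Rightarrow> real" where
  "exp_mart \<theta> t \<omega> = exp (\<theta> * B t \<omega> - \<theta>\<^sup>2 * t / 2)"

lemma B_measurable [measurable]: "0 \<le> t \<Longrightarrow> B t \<in> borel_measurable M"
  using bm unfolding brownian_motion_def by blast

lemma B_0: "\<omega> \<in> space M \<Longrightarrow> B 0 \<omega> = 0"
  using bm unfolding brownian_motion_def by blast

lemma B_cont: "\<omega> \<in> space M \<Longrightarrow> continuous_on {0..} (\<lambda>t. B t \<omega>)"
  using bm unfolding brownian_motion_def by blast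

lemma B_increment:
  "0 \<le> s \<Longrightarrow> s < t \<Longrightarrow>
    distributed M lborel (\<lambda>\<omega>. B t \<omega> - B s \<omega>) (normal_density 0 (sqrt (t - s)))"
  using bm unfolding brownian_motion_def by blast

lemma B_indep:
  "0 \<le> s \<Longrightarrow> s < t \<Longrightarrow>
    indep_set (sets (\<F> s)) {(\<lambda>\<omega>. B t \<omega> - B s \<omega>) -` A \<inter> space M | A. A \<in> sets borel}"
  using bm unfolding brownian_motion_def by blast

lemma sets_\<F>: "0 \<le> t \<Longrightarrow> sets (\<F> t) \<subseteq> sets M"
proof -
  assume t: "0 \<le> t"
  have "{B s -` A \<inter> space M | s A. 0 \<le> s \<and> s \<le> t \<and> A \<in> sets borel} \<subseteq> sets M"
    using B_measurable by (auto intro: measurable_sets)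
  moreover from this have "{B s -` A \<inter> space M | s A. 0 \<le> s \<and> s \<le> t \<and> A \<in> sets borel} \<subseteq> Pow (space M)"
    by auto
  ultimately show ?thesis
    unfolding generated_filtration_def by (simp add: sets_measure_of sets.sigma_sets_subset)
qed

lemma \<F>_imp_M: "0 \<le> t \<Longrightarrow> f \<in> borel_measurable (\<F> t) \<Longrightarrow> f \<in> borel_measurable M"
  using sets_\<F>[of t] by (auto simp: measurable_def)

lemma exp_mart_pos: "0 < exp_mart \<theta> t \<omega>"
  by (simp add: exp_mart_def)

lemma exp_mart_measurable [measurable]: "0 \<le> t \<Longrightarrow> exp_mart \<theta> t \<in> borel_measurable M"
  unfolding exp_mart_def[abs_def] by measurable

lemma exp_increment:
  assumes "0 \<le> s" "s < t"
  shows "integrable M (\<lambda>\<omega>. exp (\<theta> * (B t \<omega> - B s \<omega>) - \<theta>\<^sup>2 * (t - s) / 2))"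
    and "(\<integral>\<omega>. exp (\<theta> * (B t \<omega> - B s \<omega>) - \<theta>\<^sup>2 * (t - s) / 2) \<partial>M) = 1"
proof -
  have v: "0 < t - s" using assms by simp
  have i: "integrable M (\<lambda>\<omega>. exp (\<theta> * (B t \<omega> - B s \<omega>)))"
    using distributed_integrable[OF B_increment[OF assms], of "\<lambda>x. exp (\<theta> * x)"]
      integrable_exp_normal_density[OF v, of \<theta>] by simp
  have e: "(\<integral>\<omega>. exp (\<theta> * (B t \<omega> - B s \<omega>)) \<partial>M) = exp (\<theta>\<^sup>2 * (t - s) / 2)"
    using distributed_integral[OF B_increment[OF assms], of "\<lambda>x. exp (\<theta> * x)"]
      integral_exp_normal_density[OF v, of \<theta>] by simp
  show "integrable M (\<lambda>\<omega>. exp (\<theta> * (B t \<omega> - B s \<omega>) - \<theta>\<^sup>2 * (t - s) / 2))"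
    unfolding exp_diff using i by simp
  show "(\<integral>\<omega>. exp (\<theta> * (B t \<omega> - B s \<omega>) - \<theta>\<^sup>2 * (t - s) / 2) \<partial>M) = 1"
    unfolding exp_diff using e by simp
qed

lemma exp_mart_0: "\<omega> \<in> space M \<Longrightarrow> exp_mart \<theta> 0 \<omega> = 1"
  by (simp add: exp_mart_def B_0)

lemma
  assumes t: "0 \<le> t"
  shows exp_mart_integrable: "integrable M (exp_mart \<theta> t)"
    and exp_mart_integral: "(\<integral>\<omega>. exp_mart \<theta> t \<omega> \<partial>M) = 1"
proof -
  have "integrable M (exp_mart \<theta> t) \<and> (\<integral>\<omega>. exp_mart \<theta> t \<omega> \<partial>M) = 1"
  proof (cases "t = 0")
    case True
    have "integrable M (exp_mart \<theta> 0) \<longleftrightarrow> integrable M (\<lambda>_. 1::real)"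
      by (rule Bochner_Integration.integrable_cong) (auto simp: exp_mart_0)
    moreover have "(\<integral>\<omega>. exp_mart \<theta> 0 \<omega> \<partial>M) = (\<integral>\<omega>. 1 \<partial>M)"
      by (rule Bochner_Integration.integral_cong) (auto simp: exp_mart_0)
    ultimately show ?thesis using True by (simp add: prob_space)
  next
    case False
    let ?g = "\<lambda>\<omega>. exp (\<theta> * (B t \<omega> - B 0 \<omega>) - \<theta>\<^sup>2 * (t - 0) / 2)"
    have t': "0 < t" using False t by simp
    have eq: "exp_mart \<theta> t \<omega> = ?g \<omega>" if "\<omega> \<in> space M" for \<omega>
      using that by (simp add: exp_mart_def B_0)
    have "integrable M (exp_mart \<theta> t) \<longleftrightarrow> integrable M ?g"
      by (rule Bochner_Integration.integrable_cong) (auto simp: eq)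
    moreover have "(\<integral>\<omega>. exp_mart \<theta> t \<omega> \<partial>M) = (\<integral>\<omega>. ?g \<omega> \<partial>M)"
      by (rule Bochner_Integration.integral_cong) (auto simp: eq)
    ultimately show ?thesis using exp_increment[OF order_refl t', of \<theta>] by simp
  qed
  then show "integrable M (exp_mart \<theta> t)" "(\<integral>\<omega>. exp_mart \<theta> t \<omega> \<partial>M) = 1" by auto
qed

lemma integrable_exp_mart_indicator:
  assumes "0 \<le> t" "A \<in> sets M"
  shows "integrable M (\<lambda>\<omega>. exp_mart \<theta> t \<omega> * indicator A \<omega>)"
  using integrable_real_mult_indicator[OF assms(2) exp_mart_integrable[OF assms(1)]]
  by (simp add: mult.commute)

text \<open>The value at \<open>t\<close> is the value at \<open>s\<close> times the exponential of
  the compensated increment, which is independent of the past and has mean 1.\<close>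

lemma exp_mart_martingale:
  assumes s: "0 \<le> s" "s \<le> t" and A: "A \<in> sets (\<F> s)"
  shows "(\<integral>\<omega>. exp_mart \<theta> t \<omega> * indicator A \<omega> \<partial>M) = (\<integral>\<omega>. exp_mart \<theta> s \<omega> * indicator A \<omega> \<partial>M)"
proof (cases "s = t")
  case False
  then have st: "s < t" using s by simp
  have AM: "A \<in> sets M" using A sets_\<F>[OF s(1)] by auto
  let ?X = "\<lambda>\<omega>. exp_mart \<theta> s \<omega> * indicator A \<omega>"
  let ?D = "\<lambda>\<omega>. B t \<omega> - B s \<omega>"
  let ?h = "\<lambda>x. exp (\<theta> * x - \<theta>\<^sup>2 * (t - s) / 2)"
  let ?Y = "\<lambda>\<omega>. ?h (?D \<omega>)"
  have Bs: "B s \<in> borel_measurable (\<F> s)"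
    by (rule measurable_generated_filtration) (use s in auto)
  have XF: "?X \<in> borel_measurable (\<F> s)"
    unfolding exp_mart_def using Bs A by measurable
  have X: "?X \<in> borel_measurable M" using \<F>_imp_M[OF s(1) XF] .
  have D: "?D \<in> borel_measurable M"
    using B_measurable[of s] B_measurable[of t] s by simp
  have Y: "?Y \<in> borel_measurable M" using D by measurable
  have "indep_set (sigma_sets (space M) {?X -` A \<inter> space M | A. A \<in> sets borel})
        (sigma_sets (space M) {?Y -` A \<inter> space M | A. A \<in> sets borel})"
  proof (rule indep_set_sigma_sets)
    have 1: "{?X -` A \<inter> space M | A. A \<in> sets borel} \<subseteq> sets (\<F> s)"
      using measurable_sets[OF XF] by auto
    \<comment> \<open>\<open>brownian_motion\<close> gives independence for events of the increment
      itself. Events of its exponential are among them, events of the first factor lie in the past,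
      and both families are closed under intersection, so independence extends to the generated
      sigma-algebras.\<close>
    have 2: "{?Y -` A \<inter> space M | A. A \<in> sets borel} \<subseteq> {?D -` A \<inter> space M | A. A \<in> sets borel}"
    proof clarify
      fix A :: "real set" assume "A \<in> sets borel"
      then have "?h -` A \<in> sets borel"
        using measurable_sets[of ?h borel borel A] by simp
      moreover have "?Y -` A \<inter> space M = ?D -` (?h -` A) \<inter> space M" by auto
      ultimately show "\<exists>A'. ?Y -` A \<inter> space M = ?D -` A' \<inter> space M \<and> A' \<in> sets borel" by blast
    qed
    show "indep_set {?X -` A \<inter> space M | A. A \<in> sets borel} {?Y -` A \<inter> space M | A. A \<in> sets borel}"
      using B_indep[OF s(1) st] unfolding indep_set_def
      by (rule indep_sets_mono_sets) (use 1 2 in \<open>auto split: bool.splits\<close>)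
    show "Int_stable {?X -` A \<inter> space M | A. A \<in> sets borel}"
      "Int_stable {?Y -` A \<inter> space M | A. A \<in> sets borel}"
      by (rule Int_stable_vimage)+
  qed
  then have iv: "indep_var borel ?X borel ?Y"
    unfolding indep_var_eq using X Y by simp
  have "exp_mart \<theta> t \<omega> * indicator A \<omega> = ?X \<omega> * ?Y \<omega>" for \<omega>
  proof -
    have "\<theta> * B t \<omega> - \<theta>\<^sup>2 * t / 2 =
        (\<theta> * B s \<omega> - \<theta>\<^sup>2 * s / 2) + (\<theta> * (B t \<omega> - B s \<omega>) - \<theta>\<^sup>2 * (t - s) / 2)"
      by (simp add: field_simps)
    then have "exp_mart \<theta> t \<omega> = exp_mart \<theta> s \<omega> * ?Y \<omega>"
      unfolding exp_mart_def by (simp only: exp_add)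
    then show ?thesis by (simp add: mult_ac)
  qed
  then have "(\<integral>\<omega>. exp_mart \<theta> t \<omega> * indicator A \<omega> \<partial>M) = (\<integral>\<omega>. ?X \<omega> * ?Y \<omega> \<partial>M)"
    by (simp only:)
  also have "\<dots> = (\<integral>\<omega>. ?X \<omega> \<partial>M) * (\<integral>\<omega>. ?Y \<omega> \<partial>M)"
    by (rule indep_var_lebesgue_integral[OF iv])
       (use integrable_exp_mart_indicator[OF s(1) AM] exp_increment(1)[OF s(1) st] in auto)
  finally show ?thesis using exp_increment(2)[OF s(1) st] by simp
qed simp

text \<open>Rounding \<open>T\<close> up to a grid on \<open>[0, t]\<close> leaves finitely many
  past events to which the martingale property applies; the mesh then tends to 0. \<open>T\<close>
  may be infinite: the default \<open>real_of_ereal \<infinity> = 0\<close> is masked by the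
  indicator.\<close>

lemma optional_stopping:
  fixes T :: "'a \<Rightarrow> ereal"
  assumes T0: "\<And>\<omega>. \<omega> \<in> space M \<Longrightarrow> 0 \<le> T \<omega>"
    and stop: "\<And>s. 0 \<le> s \<Longrightarrow> {\<omega>\<in>space M. T \<omega> \<le> ereal s} \<in> sets (\<F> s)"
    and t: "0 \<le> t"
  shows "integrable M (\<lambda>\<omega>. exp_mart \<theta> (real_of_ereal (T \<omega>)) \<omega> *
           indicator {\<omega>\<in>space M. T \<omega> \<le> ereal t} \<omega>)" (is "integrable M ?Z")
    and "(\<integral>\<omega>. exp_mart \<theta> (real_of_ereal (T \<omega>)) \<omega> *
           indicator {\<omega>\<in>space M. T \<omega> \<le> ereal t} \<omega> \<partial>M) =
         (\<integral>\<omega>. exp_mart \<theta> t \<omega> * indicator {\<omega>\<in>space M. T \<omega> \<le> ereal t} \<omega> \<partial>M)"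
proof -
  define U where "U s = {\<omega>\<in>space M. T \<omega> \<le> ereal s}" for s
  define g where "g N k = real k * t / real N" for N k :: nat
  \<comment> \<open>Cell \<open>k\<close> holds the paths with \<open>T\<close> above
    \<open>g N (k - 1)\<close> and at most \<open>g N k\<close>. The case \<open>k = 0\<close> is
    separate because truncated subtraction gives \<open>k - 1 = k\<close> and would empty the
    cell.\<close>
  define A where "A N k = U (g N k) - (if k = 0 then {} else U (g N (k - 1)))" for N k
  \<comment> \<open>The martingale at \<open>T\<close> rounded up, on the event that
    \<open>T\<close> is at most \<open>t\<close>. The parameter stays free because the square for
    \<open>\<theta>\<close> is controlled by the same sum for \<open>2 * \<theta>\<close>.\<close>
  define Z where "Z \<phi> N \<omega> = (\<Sum>k\<le>N. exp_mart \<phi> (g N k) \<omega> * indicator (A N k) \<omega>)" for \<phi> N \<omega>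
  have g0: "0 \<le> g N k" for N k using t by (simp add: g_def)
  have g_mono: "g N j \<le> g N k" if "j \<le> k" for N j k
    using that t by (simp add: g_def divide_right_mono mult_right_mono)
  have g_last: "g N N = t" if "0 < N" for N using that by (simp add: g_def)
  have g_le: "g N k \<le> t" if "0 < N" "k \<le> N" for N k
    using g_mono[OF that(2), of N] g_last[OF that(1)] by simp
  have U_mono: "U r \<subseteq> U s" if "r \<le> s" for r s
    using that unfolding U_def by (auto intro: order_trans)
  have A_F: "A N k \<in> sets (\<F> (g N k))" for N k
  proof -
    have "U (g N (k - 1)) \<in> sets (\<F> (g N k))"
      using stop[OF g0, of N "k - 1"] generated_filtration_mono[OF g_mono[of "k - 1" k N]]
      unfolding U_def by auto
    then show ?thesis using stop[OF g0, of N k] unfolding A_def U_def by auto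
  qed
  have A_M: "A N k \<in> sets M" for N k using A_F sets_\<F>[OF g0] by blast
  have U_M: "U t \<in> sets M" using stop[OF t] sets_\<F>[OF t] unfolding U_def by blast
  have cell: "\<exists>k\<le>N. T \<omega> \<le> ereal (g N k) \<and> ereal (g N k) \<le> T \<omega> + ereal (t / N) \<and>
      (\<forall>f :: nat \<Rightarrow> real. (\<Sum>j\<le>N. f j * indicator (A N j) \<omega>) = f k)"
    if w: "\<omega> \<in> U t" and N: "0 < N" for \<omega> N
  proof -
    have ws: "\<omega> \<in> space M" using w by (simp add: U_def)
    define k where "k = (LEAST k. \<omega> \<in> U (g N k))"
    have wN: "\<omega> \<in> U (g N N)" using w g_last[OF N] by simp
    have kN: "k \<le> N" unfolding k_def by (rule Least_le) (rule wN)
    have wk: "\<omega> \<in> U (g N k)" unfolding k_def by (rule LeastI) (rule wN)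
    have least: "\<omega> \<notin> U (g N j)" if "j < k" for j
      using not_less_Least that unfolding k_def by blast
    have in_iff: "\<omega> \<in> A N j \<longleftrightarrow> j = k" for j
    proof
      assume j: "\<omega> \<in> A N j"
      then have "\<not> j < k" using least unfolding A_def by auto
      moreover have "\<not> k < j"
      proof
        assume kj: "k < j"
        then have "k \<le> j - 1" by simp
        then have "\<omega> \<in> U (g N (j - 1))"
          using U_mono[OF g_mono[of k "j - 1" N]] wk by blast
        then show False using j kj unfolding A_def by auto
      qed
      ultimately show "j = k" by simp
    next
      assume "j = k"
      then show "\<omega> \<in> A N j" using wk least[of "k - 1"] unfolding A_def by auto
    qed
    have "(\<Sum>j\<le>N. f j * indicator (A N j) \<omega>) = f k" for f :: "nat \<Rightarrow> real"
    proof -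
      have "(\<Sum>j\<le>N. f j * indicator (A N j) \<omega>) = (\<Sum>j\<le>N. if j = k then f j else 0)"
        by (intro sum.cong) (auto simp: in_iff indicator_def)
      also have "\<dots> = f k" using kN by simp
      finally show ?thesis .
    qed
    moreover have "ereal (g N k) \<le> T \<omega> + ereal (t / N)"
    proof (cases "k = 0")
      case True
      have "0 \<le> T \<omega> + ereal (t / N)"
        using T0[OF ws] t by (intro add_nonneg_nonneg) auto
      then show ?thesis using True by (simp add: g_def zero_ereal_def)
    next
      case False
      then have "ereal (g N (k - 1)) \<le> T \<omega>"
        using least[of "k - 1"] ws by (auto simp: U_def)
      then have "ereal (g N (k - 1)) + ereal (t / N) \<le> T \<omega> + ereal (t / N)"
        by (intro add_right_mono)
      moreover have "g N (k - 1) + t / N = g N k"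
        using False N by (simp add: g_def field_simps of_nat_diff)
      ultimately show ?thesis by simp
    qed
    ultimately show ?thesis using kN wk by (auto simp: U_def)
  qed
  have none: "(\<Sum>j\<le>N. f j * indicator (A N j) \<omega>) = 0"
    if w: "\<omega> \<notin> U t" and N: "0 < N" for \<omega> N and f :: "nat \<Rightarrow> real"
  proof -
    have "\<omega> \<notin> A N j" if "j \<le> N" for j
      using w U_mono[OF g_le[OF N that]] unfolding A_def by auto
    then show ?thesis by (intro sum.neutral) auto
  qed
  have Z_int: "integrable M (Z \<phi> N)" for \<phi> N
    unfolding Z_def
    by (intro Bochner_Integration.integrable_sum integrable_exp_mart_indicator g0 A_M)
  have Z_eq: "(\<integral>\<omega>. Z \<phi> N \<omega> \<partial>M) = (\<integral>\<omega>. exp_mart \<phi> t \<omega> * indicator (U t) \<omega> \<partial>M)"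
    if N: "0 < N" for \<phi> N
  proof -
    have "(\<integral>\<omega>. Z \<phi> N \<omega> \<partial>M) = (\<Sum>k\<le>N. \<integral>\<omega>. exp_mart \<phi> (g N k) \<omega> * indicator (A N k) \<omega> \<partial>M)"
      unfolding Z_def by (intro Bochner_Integration.integral_sum integrable_exp_mart_indicator g0 A_M)
    also have "\<dots> = (\<Sum>k\<le>N. \<integral>\<omega>. exp_mart \<phi> t \<omega> * indicator (A N k) \<omega> \<partial>M)"
      by (intro sum.cong refl exp_mart_martingale[symmetric] g0 A_F g_le N) auto
    also have "\<dots> = (\<integral>\<omega>. (\<Sum>k\<le>N. exp_mart \<phi> t \<omega> * indicator (A N k) \<omega>) \<partial>M)"
      by (intro Bochner_Integration.integral_sum[symmetric] integrable_exp_mart_indicator t A_M)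
    also have "\<dots> = (\<integral>\<omega>. exp_mart \<phi> t \<omega> * indicator (U t) \<omega> \<partial>M)"
    proof (intro Bochner_Integration.integral_cong refl)
      fix \<omega>
      show "(\<Sum>k\<le>N. exp_mart \<phi> t \<omega> * indicator (A N k) \<omega>) = exp_mart \<phi> t \<omega> * indicator (U t) \<omega>"
      proof (cases "\<omega> \<in> U t")
        case True
        from cell[OF this N] obtain k where
          "\<And>f :: nat \<Rightarrow> real. (\<Sum>j\<le>N. f j * indicator (A N j) \<omega>) = f k" by blast
        from this[of "\<lambda>_. exp_mart \<phi> t \<omega>"] True show ?thesis by (simp only: indicator_simps mult_1_right)
      next
        case False
        then show ?thesis unfolding none[OF False N] by simp
      qed
    qed
    finally show ?thesis .
  qed
  \<comment> \<open>Exactly one cell contains the path, so the square of the sum is a single square,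
    equal to \<open>exp (\<theta>^2 * s)\<close> times the martingale of parameter
    \<open>2 * \<theta>\<close> at the grid time \<open>s\<close>.\<close>
  have sq: "(Z \<theta> N \<omega>)\<^sup>2 \<le> exp (\<theta>\<^sup>2 * t) * Z (2 * \<theta>) N \<omega>" if N: "0 < N" for N \<omega>
  proof (cases "\<omega> \<in> U t")
    case True
    from cell[OF this N] obtain k where k: "k \<le> N"
      "\<And>f :: nat \<Rightarrow> real. (\<Sum>j\<le>N. f j * indicator (A N j) \<omega>) = f k" by blast
    have "(exp_mart \<theta> s \<omega>)\<^sup>2 = exp (\<theta>\<^sup>2 * s) * exp_mart (2 * \<theta>) s \<omega>" for s
      unfolding exp_mart_def power2_eq_square exp_add[symmetric]
      by (simp add: field_simps power2_eq_square)
    moreover have "exp (\<theta>\<^sup>2 * g N k) * exp_mart (2 * \<theta>) (g N k) \<omega>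
        \<le> exp (\<theta>\<^sup>2 * t) * exp_mart (2 * \<theta>) (g N k) \<omega>"
      using g_le[OF N k(1)] exp_mart_pos[of "2 * \<theta>" "g N k" \<omega>]
      by (intro mult_right_mono) (auto intro: mult_left_mono)
    ultimately show ?thesis unfolding Z_def k(2) by simp
  next
    case False
    then show ?thesis unfolding Z_def by (simp only: none[OF False N]) simp
  qed
  have Z_nonneg: "0 \<le> Z \<phi> N \<omega>" for \<phi> N \<omega>
    unfolding Z_def using exp_mart_pos by (intro sum_nonneg mult_nonneg_nonneg) (auto simp: less_imp_le)
  have sq_int: "integrable M (\<lambda>\<omega>. (Z \<theta> N \<omega>)\<^sup>2)" if N: "0 < N" for N
  proof (rule Bochner_Integration.integrable_bound)
    show "integrable M (\<lambda>\<omega>. exp (\<theta>\<^sup>2 * t) * Z (2 * \<theta>) N \<omega>)" using Z_int by simp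
    show "(\<lambda>\<omega>. (Z \<theta> N \<omega>)\<^sup>2) \<in> borel_measurable M" using borel_measurable_integrable[OF Z_int[of \<theta> N]] by simp
    show "AE \<omega> in M. norm ((Z \<theta> N \<omega>)\<^sup>2) \<le> norm (exp (\<theta>\<^sup>2 * t) * Z (2 * \<theta>) N \<omega>)"
      using sq[OF N] Z_nonneg by (auto simp: abs_mult)
  qed
  have sq_le: "(\<integral>\<omega>. (Z \<theta> N \<omega>)\<^sup>2 \<partial>M) \<le> exp (\<theta>\<^sup>2 * t)" if N: "0 < N" for N
  proof -
    have "(\<integral>\<omega>. (Z \<theta> N \<omega>)\<^sup>2 \<partial>M) \<le> (\<integral>\<omega>. exp (\<theta>\<^sup>2 * t) * Z (2 * \<theta>) N \<omega> \<partial>M)"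
      using sq_int[OF N] Z_int sq[OF N] by (intro integral_mono) auto
    also have "\<dots> = exp (\<theta>\<^sup>2 * t) * (\<integral>\<omega>. exp_mart (2 * \<theta>) t \<omega> * indicator (U t) \<omega> \<partial>M)"
      by (simp add: Z_eq[OF N])
    also have "(\<integral>\<omega>. exp_mart (2 * \<theta>) t \<omega> * indicator (U t) \<omega> \<partial>M) \<le> (\<integral>\<omega>. exp_mart (2 * \<theta>) t \<omega> \<partial>M)"
      using integrable_exp_mart_indicator[OF t U_M] exp_mart_integrable[OF t]
      by (intro integral_mono) (auto simp: indicator_def less_imp_le[OF exp_mart_pos])
    finally show ?thesis using exp_mart_integral[OF t] by simp
  qed
  \<comment> \<open>The grid time lies between \<open>T\<close> and \<open>T + t / Suc n\<close>, so
    path continuity gives the limit; \<open>Suc n\<close> keeps the mesh away from division by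
    zero.\<close>
  have lim: "(\<lambda>n. Z \<theta> (Suc n) \<omega>) \<longlonglongrightarrow> ?Z \<omega>" if w: "\<omega> \<in> space M" for \<omega>
  proof (cases "\<omega> \<in> U t")
    case True
    have Tt: "T \<omega> \<le> ereal t" using True by (simp add: U_def)
    define s where "s = real_of_ereal (T \<omega>)"
    have Ts: "T \<omega> = ereal s" using T0[OF w] Tt unfolding s_def by (cases "T \<omega>") auto
    have s0: "0 \<le> s" using T0[OF w] Ts by simp
    have "\<exists>k. \<forall>n. s \<le> g (Suc n) (k n) \<and> g (Suc n) (k n) \<le> s + t / Suc n \<and>
        Z \<theta> (Suc n) \<omega> = exp_mart \<theta> (g (Suc n) (k n)) \<omega>"
    proof (rule choice, rule allI)
      fix n
      from cell[OF True, of "Suc n"] obtain k where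
        "T \<omega> \<le> ereal (g (Suc n) k)" "ereal (g (Suc n) k) \<le> T \<omega> + ereal (t / Suc n)"
        "\<And>f :: nat \<Rightarrow> real. (\<Sum>j\<le>Suc n. f j * indicator (A (Suc n) j) \<omega>) = f k" by blast
      then show "\<exists>k. s \<le> g (Suc n) k \<and> g (Suc n) k \<le> s + t / Suc n \<and>
          Z \<theta> (Suc n) \<omega> = exp_mart \<theta> (g (Suc n) k) \<omega>"
        unfolding Z_def Ts by auto
    qed
    then obtain k where k: "\<And>n. s \<le> g (Suc n) (k n)" "\<And>n. g (Suc n) (k n) \<le> s + t / Suc n"
      "\<And>n. Z \<theta> (Suc n) \<omega> = exp_mart \<theta> (g (Suc n) (k n)) \<omega>" by blast
    have gs: "(\<lambda>n. g (Suc n) (k n)) \<longlonglongrightarrow> s"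
    proof (rule tendsto_sandwich)
      show "\<forall>\<^sub>F n in sequentially. s \<le> g (Suc n) (k n)"
        by (intro always_eventually allI k(1))
      show "\<forall>\<^sub>F n in sequentially. g (Suc n) (k n) \<le> s + t / real (Suc n)"
        by (intro always_eventually allI k(2))
      show "(\<lambda>n. s + t / real (Suc n)) \<longlonglongrightarrow> s" by real_asymp
    qed simp
    have "continuous_on {0..} (\<lambda>r. exp_mart \<theta> r \<omega>)"
      unfolding exp_mart_def by (intro continuous_intros B_cont w) auto
    from continuous_on_tendsto_compose[OF this gs] s0 g0
    have "(\<lambda>n. exp_mart \<theta> (g (Suc n) (k n)) \<omega>) \<longlonglongrightarrow> exp_mart \<theta> s \<omega>" by auto
    then show ?thesis using w Tt by (simp add: k(3) Ts)
  next
    case False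
    then have "?Z \<omega> = 0" by (simp add: U_def)
    then show ?thesis unfolding Z_def by (simp only: none[OF False] zero_less_Suc tendsto_const)
  qed
  define Y where "Y n = Z \<theta> (Suc n)" for n
  have Y: "integrable M (Y n)" "0 \<le> Y n \<omega>"
      "(\<integral>\<omega>. Y n \<omega> \<partial>M) = (\<integral>\<omega>. exp_mart \<theta> t \<omega> * indicator (U t) \<omega> \<partial>M)"
      "integrable M (\<lambda>\<omega>. (Y n \<omega>)\<^sup>2)" "(\<integral>\<omega>. (Y n \<omega>)\<^sup>2 \<partial>M) \<le> exp (\<theta>\<^sup>2 * t)" for n \<omega>
    unfolding Y_def
    by (rule Z_int, rule Z_nonneg, rule Z_eq[OF zero_less_Suc], rule sq_int[OF zero_less_Suc],
        rule sq_le[OF zero_less_Suc])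
  have Y_lim: "(\<lambda>n. Y n \<omega>) \<longlonglongrightarrow> ?Z \<omega>" if "\<omega> \<in> space M" for \<omega>
    unfolding Y_def by (rule lim[OF that])
  note conv = square_bounded_imp_integral_tendsto[of M Y ?Z, OF Y_lim Y(2,1,3,4,5) finite_measure_axioms]
  show "integrable M ?Z" by (rule conv(1))
  show "(\<integral>\<omega>. ?Z \<omega> \<partial>M) =
     (\<integral>\<omega>. exp_mart \<theta> t \<omega> * indicator {\<omega>\<in>space M. T \<omega> \<le> ereal t} \<omega> \<partial>M)"
    using conv(2) by (simp only: U_def)
qed

end

section \<open>Discounted profits up to a hitting time\<close>

text \<open>Reading the path at the grid time below \<open>t\<close> involves countably many
  measurable variables, and continuity carries joint measurability to the limit. \<open>nat\<close>
  sends negative times to 0, hence the \<open>max\<close>.\<close>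

lemma measurable_pair_continuous_path:
  fixes X :: "real \<Rightarrow> 'a \<Rightarrow> real"
  assumes X: "\<And>t. 0 \<le> t \<Longrightarrow> X t \<in> borel_measurable M"
    and cont: "\<And>\<omega>. \<omega> \<in> space M \<Longrightarrow> continuous_on {0..} (\<lambda>t. X t \<omega>)"
  shows "(\<lambda>z. X (max 0 (snd z)) (fst z)) \<in> borel_measurable (M \<Otimes>\<^sub>M lborel)"
proof (rule borel_measurable_LIMSEQ_real)
  let ?k = "\<lambda>n t. real (nat \<lfloor>real (Suc n) * t\<rfloor>) / real (Suc n)"
  fix z :: "'a \<times> real" assume "z \<in> space (M \<Otimes>\<^sub>M lborel)"
  then have w: "fst z \<in> space M" by (auto simp: space_pair_measure)
  have b: "max 0 t - 1 / real (Suc n) \<le> ?k n t" "?k n t \<le> max 0 t" for n t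
  proof -
    have "real (nat \<lfloor>real (Suc n) * t\<rfloor>) \<le> max 0 (real (Suc n) * t)" by linarith
    also have "\<dots> = max 0 t * real (Suc n)" by (auto simp: max_def mult_less_0_iff zero_le_mult_iff)
    finally show "?k n t \<le> max 0 t" by (rule mult_imp_div_pos_le[rotated]) simp
    have "max 0 t * real (Suc n) = max 0 (real (Suc n) * t)"
      by (auto simp: max_def mult_less_0_iff zero_le_mult_iff)
    also have "\<dots> \<le> real (nat \<lfloor>real (Suc n) * t\<rfloor>) + 1" by linarith
    finally have "max 0 t \<le> (real (nat \<lfloor>real (Suc n) * t\<rfloor>) + 1) / real (Suc n)"
      by (rule mult_imp_le_div_pos[rotated]) simp
    then show "max 0 t - 1 / real (Suc n) \<le> ?k n t"
      by (simp only: add_divide_distrib diff_le_eq)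
  qed
  have "(\<lambda>n. ?k n (snd z)) \<longlonglongrightarrow> max 0 (snd z)"
  proof (rule tendsto_sandwich)
    show "(\<lambda>n. max 0 (snd z) - 1 / real (Suc n)) \<longlonglongrightarrow> max 0 (snd z)" by real_asymp
    show "(\<lambda>n. max 0 (snd z)) \<longlonglongrightarrow> max 0 (snd z)" by simp
  qed (use b in auto)
  then show "(\<lambda>n. X (?k n (snd z)) (fst z)) \<longlonglongrightarrow> X (max 0 (snd z)) (fst z)"
    by (rule continuous_on_tendsto_compose[OF cont[OF w]]) auto
next
  fix n
  show "(\<lambda>z. X (real (nat \<lfloor>real (Suc n) * snd z\<rfloor>) / real (Suc n)) (fst z)) \<in> borel_measurable (M \<Otimes>\<^sub>M lborel)"
  proof (rule measurable_compose_countable[where f="\<lambda>i z. X (real i / real (Suc n)) (fst z)"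
        and g="\<lambda>z. nat \<lfloor>real (Suc n) * snd z\<rfloor>"])
    fix i :: nat
    have [measurable]: "X (real i / real (Suc n)) \<in> borel_measurable M" by (rule X) auto
    show "(\<lambda>z. X (real i / real (Suc n)) (fst z)) \<in> borel_measurable (M \<Otimes>\<^sub>M lborel)"
      by measurable
  qed measurable
qed

section \<open>The market under the pricing measure\<close>

locale market =
  fixes m :: "'a model"
  assumes pricing_bm:
      "brownian_motion (pricing m) (\<lambda>t \<omega>. noise m t \<omega> + price_of_risk m * t)"
    and eta_pos: "0 < eta m" and delta_pos: "0 < delta m" and cost_pos: "0 < cost m"
    and D2_pos: "0 < D2 m" and D2_less_D1: "D2 m < D1 m"
begin

text \<open>From here on \<open>\<F>\<close> is generated by the drifted noise, which is the
  Brownian motion under the pricing measure; stopping times are checked against it.\<close>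

sublocale brownian "pricing m" "\<lambda>t \<omega>. noise m t \<omega> + price_of_risk m * t"
  by unfold_locales (rule pricing_bm)

text \<open>The discriminant equals \<open>(1 - a)\<^sup>2 + 2 * delta m / (eta m)\<^sup>2\<close>,
  so \<open>delta m > 0\<close> gives \<open>beta m > 1\<close> whatever the sign of
  \<open>rate m\<close>. The root equation is the drift condition that makes the discounted power a
  martingale.\<close>

lemma beta_gt_1: "1 < beta m"
  and beta_root: "(eta m)\<^sup>2 / 2 * beta m * (beta m - 1) + (rate m - delta m) * beta m = rate m"
proof -
  define a where "a = 1/2 - (rate m - delta m) / (eta m)\<^sup>2"
  define d where "d = a\<^sup>2 + 2 * rate m / (eta m)\<^sup>2"
  have e2: "0 < (eta m)\<^sup>2" using eta_pos by simp
  have d1: "d = (1 - a)\<^sup>2 + 2 * delta m / (eta m)\<^sup>2"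
  proof -
    define k where "k = (rate m - delta m) / (eta m)\<^sup>2"
    have "2 * k = 2 * rate m / (eta m)\<^sup>2 - 2 * delta m / (eta m)\<^sup>2"
      by (simp add: k_def diff_divide_distrib[symmetric])
    then show ?thesis
      unfolding d_def a_def k_def[symmetric] by (simp add: power2_eq_square algebra_simps)
  qed
  have "(1 - a)\<^sup>2 < d" using d1 delta_pos e2 by simp
  then have s: "\<bar>1 - a\<bar> < sqrt d" by (simp add: real_less_rsqrt)
  have b: "beta m = a + sqrt d" unfolding beta_def a_def d_def ..
  show b1: "1 < beta m" using s b by linarith
  have "0 \<le> d" using d1 delta_pos e2 by (simp add: add_nonneg_nonneg)
  then have "(beta m - a)\<^sup>2 = d" using b by simp
  then have "(beta m)\<^sup>2 - 2 * a * beta m = 2 * rate m / (eta m)\<^sup>2"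
    by (simp add: d_def power2_eq_square algebra_simps)
  then have "(eta m)\<^sup>2 / 2 * ((beta m)\<^sup>2 - 2 * a * beta m) = rate m" using e2 by simp
  moreover have "(eta m)\<^sup>2 / 2 * ((beta m)\<^sup>2 - 2 * a * beta m) =
      (eta m)\<^sup>2 / 2 * beta m * (beta m - 1) + (rate m - delta m) * beta m"
  proof -
    have "(eta m)\<^sup>2 * ((rate m - delta m) / (eta m)\<^sup>2) = rate m - delta m" using e2 by simp
    then have ea: "(eta m)\<^sup>2 * a = (eta m)\<^sup>2 / 2 - (rate m - delta m)"
      by (simp only: a_def right_diff_distrib)
    have "(eta m)\<^sup>2 / 2 * ((beta m)\<^sup>2 - 2 * a * beta m) =
        (eta m)\<^sup>2 / 2 * (beta m)\<^sup>2 - (eta m)\<^sup>2 * a * beta m"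
      by (simp add: algebra_simps)
    then show ?thesis unfolding ea by (simp add: power2_eq_square field_simps)
  qed
  ultimately show "(eta m)\<^sup>2 / 2 * beta m * (beta m - 1) + (rate m - delta m) * beta m = rate m"
    by simp
qed

lemma YF_pos: "0 < YF m"
  unfolding YF_def using delta_pos cost_pos D2_pos beta_gt_1 by simp

lemma profit_pos: "0 < x \<Longrightarrow> 0 < profit m x t \<omega>"
  by (simp add: profit_def)

lemma profit_0: "\<omega> \<in> space (pricing m) \<Longrightarrow> profit m x 0 \<omega> = x"
  using B_0[of \<omega>] by (simp add: profit_def)

lemma discounted_profit:
  "exp (- rate m * t) * profit m x t \<omega> = x * exp (- delta m * t) * exp_mart (eta m) t \<omega>"
proof -
  have "nu m - (eta m)\<^sup>2 / 2 - rate m = - delta m + eta m * price_of_risk m - (eta m)\<^sup>2 / 2"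
    by (simp add: delta_def)
  then have "- rate m * t + ((nu m - (eta m)\<^sup>2 / 2) * t + eta m * noise m t \<omega>) =
      - delta m * t + (eta m * (noise m t \<omega> + price_of_risk m * t) - (eta m)\<^sup>2 * t / 2)"
    by (simp add: algebra_simps delta_def)
  then show ?thesis unfolding profit_def exp_mart_def
    by (simp only: exp_add[symmetric] mult.assoc mult.left_commute[of _ x])
qed

lemma discounted_power:
  assumes x: "0 < x"
  shows "exp (- rate m * t) * (profit m x t \<omega> / x) powr beta m = exp_mart (beta m * eta m) t \<omega>"
proof -
  have p: "(profit m x t \<omega> / x) powr beta m =
      exp (beta m * ((nu m - (eta m)\<^sup>2 / 2) * t + eta m * noise m t \<omega>))"
    using x by (simp add: profit_def powr_def)
  have "nu m = rate m - delta m + eta m * price_of_risk m" by (simp add: delta_def)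
  then have "- rate m * t + beta m * ((nu m - (eta m)\<^sup>2 / 2) * t + eta m * noise m t \<omega>) =
      - rate m * t + beta m * ((rate m - delta m + eta m * price_of_risk m - (eta m)\<^sup>2 / 2) * t
        + eta m * noise m t \<omega>)" by (simp only:)
  \<comment> \<open>What multiplies \<open>t\<close> beyond the martingale exponent is the
    characteristic quadratic minus \<open>rate m\<close>, which \<open>beta_root\<close>
    annihilates.\<close>
  also have "\<dots> = (beta m * (eta m * noise m t \<omega> + eta m * price_of_risk m * t)
      - (beta m * eta m)\<^sup>2 * t / 2)
      + t * ((eta m)\<^sup>2 / 2 * beta m * (beta m - 1) + (rate m - delta m) * beta m - rate m)"
    by (simp add: field_simps power2_eq_square)
  also have "\<dots> = beta m * eta m * (noise m t \<omega> + price_of_risk m * t) - (beta m * eta m)\<^sup>2 * t / 2"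
    unfolding beta_root by (simp add: algebra_simps)
  finally have "- rate m * t + beta m * ((nu m - (eta m)\<^sup>2 / 2) * t + eta m * noise m t \<omega>) =
      beta m * eta m * (noise m t \<omega> + price_of_risk m * t) - (beta m * eta m)\<^sup>2 * t / 2" .
  then show ?thesis unfolding p exp_mart_def exp_add[symmetric] by simp
qed

section \<open>Continuity of paths and first hitting times\<close>

lemma noise_cont: "\<omega> \<in> space (pricing m) \<Longrightarrow> continuous_on {0..} (\<lambda>t. noise m t \<omega>)"
proof -
  assume w: "\<omega> \<in> space (pricing m)"
  have "continuous_on {0..} (\<lambda>t. noise m t \<omega> + price_of_risk m * t - price_of_risk m * t)"
    by (intro continuous_on_diff[OF B_cont[OF w]] continuous_intros)
  then show ?thesis by simp
qed

lemma profit_cont: "\<omega> \<in> space (pricing m) \<Longrightarrow> continuous_on {0..} (\<lambda>t. profit m x t \<omega>)"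
  unfolding profit_def by (intro continuous_intros noise_cont)

lemma profit_measurable_\<F>:
  assumes "0 \<le> s" "s \<le> t"
  shows "profit m x s \<in> borel_measurable (\<F> t)"
proof -
  have "(\<lambda>\<omega>. noise m s \<omega> + price_of_risk m * s) \<in> borel_measurable (\<F> t)"
    using measurable_generated_filtration[OF assms,
        where W="\<lambda>t \<omega>. noise m t \<omega> + price_of_risk m * t"] by simp
  then have "(\<lambda>\<omega>. noise m s \<omega> + price_of_risk m * s - price_of_risk m * s) \<in> borel_measurable (\<F> t)"
    by (rule borel_measurable_diff) simp
  then have [measurable]: "noise m s \<in> borel_measurable (\<F> t)" by simp
  show ?thesis unfolding profit_def[abs_def] by measurable
qed

lemma profit_measurable: "0 \<le> t \<Longrightarrow> profit m x t \<in> borel_measurable (pricing m)"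
  by (rule \<F>_imp_M[OF _ profit_measurable_\<F>]) auto

text \<open>By continuity the set of times spent at or above \<open>c\<close> is closed, so its
  infimum is attained unless the set is empty. Later facts on \<open>hit\<close> are read off from
  these two cases.\<close>

lemma hit_cases:
  assumes w: "\<omega> \<in> space (pricing m)"
  obtains (never) "hit m x c \<omega> = \<infinity>" "\<And>s. 0 \<le> s \<Longrightarrow> profit m x s \<omega> < c"
  | (at) s where "0 \<le> s" "hit m x c \<omega> = ereal s" "c \<le> profit m x s \<omega>"
      "\<And>u. 0 \<le> u \<Longrightarrow> u < s \<Longrightarrow> profit m x u \<omega> < c"
proof -
  define K where "K = {t. 0 \<le> t \<and> c \<le> profit m x t \<omega>}"
  have hit: "hit m x c \<omega> = (INF t\<in>K. ereal t)" by (simp add: hit_def K_def)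
  show thesis
  proof (cases "K = {}")
    case True
    show thesis
    proof (rule never)
      show "hit m x c \<omega> = \<infinity>" using True by (simp add: hit top_ereal_def)
      show "profit m x s \<omega> < c" if "0 \<le> s" for s using True that unfolding K_def by force
    qed
  next
    case False
    have "K = {0..} \<inter> (\<lambda>t. profit m x t \<omega>) -` {c..}" by (auto simp: K_def)
    moreover have "closed ({0..} \<inter> (\<lambda>t. profit m x t \<omega>) -` {c..})"
      by (intro continuous_closed_preimage profit_cont w closed_atLeast)
    ultimately have cl: "closed K" by simp
    have bd: "bdd_below K" by (rule bdd_belowI[of _ 0]) (auto simp: K_def)
    have InfK: "Inf K \<in> K" by (rule closed_contains_Inf[OF False bd cl])
    have lower: "Inf K \<le> u" if "u \<in> K" for u by (rule cInf_lower[OF that bd])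
    have "hit m x c \<omega> = ereal (Inf K)"
      unfolding hit using InfK lower by (intro antisym INF_lower INF_greatest) auto
    then show thesis using InfK lower by (intro at[of "Inf K"]) (auto simp: K_def not_le[symmetric])
  qed
qed

lemma hit_le_iff:
  assumes w: "\<omega> \<in> space (pricing m)" and t: "0 \<le> t"
  shows "hit m x c \<omega> \<le> ereal t \<longleftrightarrow> (\<exists>s\<in>{0..t}. c \<le> profit m x s \<omega>)"
  by (rule hit_cases[OF w, of x c]) (force simp: not_le[symmetric])+

lemma hit_nonneg: "\<omega> \<in> space (pricing m) \<Longrightarrow> 0 \<le> hit m x c \<omega>"
  by (rule hit_cases[of \<omega> x c]) auto

lemma hit_eq_0:
  assumes w: "\<omega> \<in> space (pricing m)" and "c \<le> x"
  shows "hit m x c \<omega> = 0"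
proof -
  have "hit m x c \<omega> \<le> ereal 0"
    unfolding hit_le_iff[OF w order_refl] using assms profit_0[OF w] by auto
  then show ?thesis using hit_nonneg[OF w] by (intro antisym) (auto simp: zero_ereal_def)
qed

lemma profit_hit:
  assumes w: "\<omega> \<in> space (pricing m)" and x: "x \<le> c" and h: "hit m x c \<omega> \<noteq> \<infinity>"
  shows "profit m x (real_of_ereal (hit m x c \<omega>)) \<omega> = c"
  using w
proof (cases rule: hit_cases[of \<omega> x c])
  case never
  then show ?thesis using h by simp
next
  case (at s)
  have "profit m x s \<omega> \<le> c"
  \<comment> \<open>The strict bound before the hit passes to \<open>s\<close> only if there are
    earlier times; at \<open>s = 0\<close> the assumption on the starting level takes its
    place.\<close>
  proof (cases "s = 0")
    case True
    then show ?thesis using profit_0[OF w] x by simp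
  next
    case False
    then have cl: "closure {0..<s} = {0..s}" using at by (intro closure_atLeastLessThan) auto
    have "continuous_on (closure {0..<s}) (\<lambda>u. profit m x u \<omega>)"
      unfolding cl by (rule continuous_on_subset[OF profit_cont[OF w]]) auto
    then show ?thesis
      by (rule continuous_le_on_closure) (use at cl in \<open>auto intro: less_imp_le\<close>)
  qed
  then show ?thesis using at by simp
qed

lemma hit_stopping:
  assumes s: "0 \<le> s"
  shows "{\<omega>\<in>space (pricing m). hit m x c \<omega> \<le> ereal s} \<in> sets (\<F> s)"
proof -
  have "{\<omega>\<in>space (\<F> s). \<exists>u\<in>{0..s}. c \<le> profit m x u \<omega>} \<in> sets (\<F> s)"
  proof (rule running_max_sets)
    show "continuous_on {0..s} (\<lambda>u. profit m x u \<omega>)" if "\<omega> \<in> space (\<F> s)" for \<omega>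
      by (rule continuous_on_subset[OF profit_cont]) (use that in auto)
  qed (use profit_measurable_\<F> s in auto)
  moreover have "{\<omega>\<in>space (\<F> s). \<exists>u\<in>{0..s}. c \<le> profit m x u \<omega>} =
      {\<omega>\<in>space (pricing m). hit m x c \<omega> \<le> ereal s}"
    using hit_le_iff[OF _ s] by auto
  ultimately show ?thesis by simp
qed

lemma hit_measurable [measurable]: "hit m x c \<in> borel_measurable (pricing m)"
proof (rule borel_measurableI_le)
  fix y :: ereal
  consider (pos) u where "y = ereal u" "0 \<le> u" | (inf) "y = \<infinity>" | (neg) "y < 0"
    by (cases y) force+
  then show "{\<omega>\<in>space (pricing m). hit m x c \<omega> \<le> y} \<in> sets (pricing m)"
  proof cases
    case pos
    then show ?thesis using hit_stopping sets_\<F> by blast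
  next
    case neg
    then have "{\<omega>\<in>space (pricing m). hit m x c \<omega> \<le> y} = {}"
      using hit_nonneg[of _ x c] by (auto simp: not_le intro: less_le_trans)
    then show ?thesis by (simp only: sets.empty_sets)
  qed simp
qed

lemma discount_nonneg: "0 \<le> discount m T"
  by (simp add: discount_def)

lemma discount_hit_measurable [measurable]:
  "(\<lambda>\<omega>. discount m (hit m x c \<omega>)) \<in> borel_measurable (pricing m)"
  unfolding discount_def by measurable

lemma
  assumes x: "0 < x" "x \<le> c"
  shows integrable_discount_hit: "integrable (pricing m) (\<lambda>\<omega>. discount m (hit m x c \<omega>))"
    and integral_discount_hit:
      "(\<integral>\<omega>. discount m (hit m x c \<omega>) \<partial>pricing m) = (x / c) powr beta m"
proof -
  let ?T = "\<lambda>\<omega>. hit m x c \<omega>"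
  let ?U = "\<lambda>n. {\<omega>\<in>space (pricing m). ?T \<omega> \<le> ereal (real n)}"
  let ?E = "exp_mart (beta m * eta m)"
  let ?D = "\<lambda>n \<omega>. discount m (?T \<omega>) * indicator (?U n) \<omega>"
  have c: "0 < c" using x by simp
  have U: "?U n \<in> sets (pricing m)" for n using hit_stopping[of "real n"] sets_\<F>[of "real n"] by auto
  \<comment> \<open>At the hitting time the profit equals \<open>c\<close>, so the martingale there
    is the discount factor times the constant \<open>(c / x) powr beta m\<close>.\<close>
  have D_eq: "?D n \<omega> = (x / c) powr beta m * (?E (real_of_ereal (?T \<omega>)) \<omega> * indicator (?U n) \<omega>)" for n \<omega>
  proof (cases "\<omega> \<in> ?U n")
    case True
    then have w: "\<omega> \<in> space (pricing m)" and fin: "?T \<omega> \<noteq> \<infinity>" by auto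
    have "?E (real_of_ereal (?T \<omega>)) \<omega> = exp (- rate m * real_of_ereal (?T \<omega>)) * (c / x) powr beta m"
      using discounted_power[OF x(1), of "real_of_ereal (?T \<omega>)" \<omega>] profit_hit[OF w x(2) fin] by simp
    moreover have "(x / c) powr beta m * (c / x) powr beta m = 1"
      using x c by (simp add: powr_mult[symmetric])
    ultimately show ?thesis using True fin by (simp add: discount_def mult_ac)
  qed simp
  have stop: "integrable (pricing m) (\<lambda>\<omega>. ?E (real_of_ereal (?T \<omega>)) \<omega> * indicator (?U n) \<omega>)"
    "(\<integral>\<omega>. ?E (real_of_ereal (?T \<omega>)) \<omega> * indicator (?U n) \<omega> \<partial>pricing m) =
     (\<integral>\<omega>. ?E (real n) \<omega> * indicator (?U n) \<omega> \<partial>pricing m)" for n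
    using optional_stopping[where T="?T" and t="real n", OF hit_nonneg hit_stopping] by auto
  have D_int: "integrable (pricing m) (?D n)" for n
    unfolding D_eq using stop by simp
  have D_val: "(\<integral>\<omega>. ?D n \<omega> \<partial>pricing m) =
      (x / c) powr beta m * (\<integral>\<omega>. ?E (real n) \<omega> * indicator (?U n) \<omega> \<partial>pricing m)" for n
    unfolding D_eq using stop by simp
  \<comment> \<open>On paths not yet stopped the profit is at most \<open>c\<close>. Since
    \<open>beta m - 1\<close> is positive, all but one factor \<open>?y / x\<close> of the power is
    replaced by its value at \<open>c\<close>; the remaining factor supplies the decay in
    \<open>n\<close>.\<close>
  have rest: "?E (real n) \<omega> - ?E (real n) \<omega> * indicator (?U n) \<omega>
      \<le> (c / x) powr (beta m - 1) * exp (- delta m * real n) * exp_mart (eta m) (real n) \<omega>"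
    if w: "\<omega> \<in> space (pricing m)" for n \<omega>
  proof (cases "\<omega> \<in> ?U n")
    case True
    then show ?thesis using exp_mart_pos[of "eta m" "real n" \<omega>] by simp
  next
    case False
    let ?y = "profit m x (real n) \<omega>"
    have yc: "?y \<le> c"
      using False w hit_le_iff[OF w, of "real n" x c] by (auto simp: not_le less_imp_le)
    have y: "0 < ?y" using profit_pos x by simp
    have "(?y / x) powr beta m = (?y / x) powr (beta m - 1) * (?y / x)"
      using y x by (simp add: powr_diff)
    also have "\<dots> \<le> (c / x) powr (beta m - 1) * (?y / x)"
      using yc y x beta_gt_1 by (intro mult_right_mono powr_mono2) (auto simp: divide_right_mono)
    finally have "exp (- rate m * real n) * (?y / x) powr beta m \<le>
        exp (- rate m * real n) * ((c / x) powr (beta m - 1) * (?y / x))"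
      by (intro mult_left_mono) auto
    then have "?E (real n) \<omega> \<le> (c / x) powr (beta m - 1) * ((exp (- rate m * real n) * ?y) / x)"
      unfolding discounted_power[OF x(1)] by (simp add: mult_ac)
    then show ?thesis using False x unfolding discounted_profit by (simp add: mult_ac)
  qed
  have conv: "(\<lambda>n. \<integral>\<omega>. ?E (real n) \<omega> * indicator (?U n) \<omega> \<partial>pricing m) \<longlonglongrightarrow> 1"
  proof (rule tendsto_sandwich)
    show "(\<lambda>n. 1 - (c / x) powr (beta m - 1) * exp (- delta m * real n)) \<longlonglongrightarrow> 1"
      using delta_pos by real_asymp
    have "1 - (c / x) powr (beta m - 1) * exp (- delta m * real n)
        \<le> (\<integral>\<omega>. ?E (real n) \<omega> * indicator (?U n) \<omega> \<partial>pricing m)" for n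
    proof -
      have "(\<integral>\<omega>. ?E (real n) \<omega> - ?E (real n) \<omega> * indicator (?U n) \<omega> \<partial>pricing m)
        \<le> (\<integral>\<omega>. (c / x) powr (beta m - 1) * exp (- delta m * real n) * exp_mart (eta m) (real n) \<omega> \<partial>pricing m)"
        using rest integrable_exp_mart_indicator[OF _ U] exp_mart_integrable
        by (intro integral_mono) auto
      then show ?thesis
        using integrable_exp_mart_indicator[OF _ U[of n], of "real n" "beta m * eta m"]
          exp_mart_integrable exp_mart_integral
        by (simp add: Bochner_Integration.integral_diff)
    qed
    then show "\<forall>\<^sub>F n in sequentially. 1 - (c / x) powr (beta m - 1) * exp (- delta m * real n)
        \<le> (\<integral>\<omega>. ?E (real n) \<omega> * indicator (?U n) \<omega> \<partial>pricing m)" by simp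
    have "(\<integral>\<omega>. ?E (real n) \<omega> * indicator (?U n) \<omega> \<partial>pricing m) \<le> (\<integral>\<omega>. ?E (real n) \<omega> \<partial>pricing m)" for n
      using integrable_exp_mart_indicator[OF _ U] exp_mart_integrable
      by (intro integral_mono) (auto simp: indicator_def less_imp_le[OF exp_mart_pos])
    then show "\<forall>\<^sub>F n in sequentially. (\<integral>\<omega>. ?E (real n) \<omega> * indicator (?U n) \<omega> \<partial>pricing m) \<le> 1"
      using exp_mart_integral by simp
  qed simp
  \<comment> \<open>The discount factor is unbounded when \<open>rate m\<close> is negative, so the
    limit rests on monotonicity of the indicators.\<close>
  have mono: "AE \<omega> in pricing m. mono (\<lambda>n. ?D n \<omega>)"
    by (auto intro!: AE_I2 monoI mult_left_mono discount_nonneg simp: indicator_def)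
       (erule order_trans, simp)
  have lim: "AE \<omega> in pricing m. (\<lambda>n. ?D n \<omega>) \<longlonglongrightarrow> discount m (?T \<omega>)"
  proof (rule AE_I2)
    fix \<omega> assume w: "\<omega> \<in> space (pricing m)"
    show "(\<lambda>n. ?D n \<omega>) \<longlonglongrightarrow> discount m (?T \<omega>)"
    proof (cases "?T \<omega> = \<infinity>")
      case True
      then show ?thesis by (simp add: discount_def)
    next
      case False
      then obtain s where s: "?T \<omega> = ereal s" using hit_nonneg[OF w, of x c] by (cases "?T \<omega>") auto
      obtain k :: nat where k: "s \<le> real k" using real_arch_simple by blast
      have "\<forall>\<^sub>F n in sequentially. ?D n \<omega> = discount m (?T \<omega>)"
        using k w s by (intro eventually_sequentiallyI[of k]) auto
      then show ?thesis by (rule tendsto_eventually)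
    qed
  qed
  have "(\<lambda>n. \<integral>\<omega>. ?D n \<omega> \<partial>pricing m) \<longlonglongrightarrow> (x / c) powr beta m"
    using tendsto_mult[OF tendsto_const conv, of "(x / c) powr beta m"]
    by (simp only: D_val mult_1_right)
  note mc = D_int mono lim this discount_hit_measurable
  show "integrable (pricing m) (\<lambda>\<omega>. discount m (hit m x c \<omega>))"
    by (rule integrable_monotone_convergence[OF mc])
  show "(\<integral>\<omega>. discount m (hit m x c \<omega>) \<partial>pricing m) = (x / c) powr beta m"
    by (rule integral_monotone_convergence[OF mc])
qed

end

section \<open>Discounted cash-flows from a hitting time on\<close>

lemma nn_integral_exp_atLeast:
  fixes d h :: real
  assumes d: "0 < d"
  shows "(\<integral>\<^sup>+t. ennreal (indicator {h..} t * exp (- d * t)) \<partial>lborel) = ennreal (exp (- d * h) / d)"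
proof -
  have "(\<integral>\<^sup>+t. ennreal (exp (- d * t)) * indicator {h..} t \<partial>lborel) = ennreal (0 - (- exp (- d * h) / d))"
  proof (rule nn_integral_FTC_atLeast)
    show "((\<lambda>t. - exp (- d * t) / d) has_real_derivative exp (- d * t)) (at t)" for t
      using d by (auto intro!: derivative_eq_intros)
    show "((\<lambda>t. - exp (- d * t) / d) \<longlongrightarrow> 0) at_top"
      using d by real_asymp
  qed auto
  moreover have "ennreal (exp (- d * t)) * indicator {h..} t = ennreal (indicator {h..} t * exp (- d * t))" for t
    by (simp add: indicator_def)
  ultimately show ?thesis by simp
qed

context market
begin

sublocale time: pair_sigma_finite "pricing m" "lborel :: real measure"
  by unfold_locales

text \<open>The discounted profit counted from the first time \<open>c\<close> is reached. With
  \<open>c = x\<close> it is the whole stream, so the leader's and the follower's cash-flows are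
  combinations of such flows.\<close>

definition flow :: "real \<Rightarrow> real \<Rightarrow> 'a \<Rightarrow> real \<Rightarrow> real" where
  "flow x c \<omega> t = indicator {t. 0 \<le> t \<and> hit m x c \<omega> \<le> ereal t} t *
     (exp (- rate m * t) * profit m x t \<omega>)"

lemma flow_measurable: "(\<lambda>z. flow x c (fst z) (snd z)) \<in> borel_measurable (pricing m \<Otimes>\<^sub>M lborel)"
proof -
  have [measurable]: "(\<lambda>z. profit m x (max 0 (snd z)) (fst z)) \<in> borel_measurable (pricing m \<Otimes>\<^sub>M lborel)"
    by (rule measurable_pair_continuous_path[OF profit_measurable profit_cont])
  have "flow x c \<omega> t = (if 0 \<le> t \<and> hit m x c \<omega> \<le> ereal t
      then exp (- rate m * t) * profit m x (max 0 t) \<omega> else 0)" for \<omega> t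
    by (simp add: flow_def)
  then show ?thesis by simp
qed

lemma flow_nonneg: "0 < x \<Longrightarrow> 0 \<le> flow x c \<omega> t"
  unfolding flow_def using profit_pos[of x t \<omega>] by simp

text \<open>Optional stopping freezes the martingale part of the discounted profit at the hitting time,
  which leaves a deterministic exponential decay from level \<open>c\<close> on.\<close>

lemma nn_integral_flow:
  assumes x: "0 < x" "x \<le> c" and t: "0 \<le> t"
  shows "(\<integral>\<^sup>+\<omega>. ennreal (flow x c \<omega> t) \<partial>pricing m) =
    (\<integral>\<^sup>+\<omega>. ennreal (indicator {t. 0 \<le> t \<and> hit m x c \<omega> \<le> ereal t} t *
       (c * exp (- delta m * t) * exp ((delta m - rate m) * real_of_ereal (hit m x c \<omega>)))) \<partial>pricing m)"
proof -
  let ?U = "{\<omega>\<in>space (pricing m). hit m x c \<omega> \<le> ereal t}"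
  let ?S = "\<lambda>\<omega>. exp_mart (eta m) (real_of_ereal (hit m x c \<omega>)) \<omega> * indicator ?U \<omega>"
  have U: "?U \<in> sets (pricing m)" using hit_stopping[OF t] sets_\<F>[OF t] by auto
  have 1: "flow x c \<omega> t = x * exp (- delta m * t) * (exp_mart (eta m) t \<omega> * indicator ?U \<omega>)"
    if "\<omega> \<in> space (pricing m)" for \<omega>
    using that t unfolding flow_def discounted_profit by (simp add: indicator_def)
  have 2: "indicator {t. 0 \<le> t \<and> hit m x c \<omega> \<le> ereal t} t *
       (c * exp (- delta m * t) * exp ((delta m - rate m) * real_of_ereal (hit m x c \<omega>))) =
       x * exp (- delta m * t) * ?S \<omega>" if w: "\<omega> \<in> space (pricing m)" for \<omega>
  proof (cases "hit m x c \<omega> \<le> ereal t")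
    case True
    let ?h = "real_of_ereal (hit m x c \<omega>)"
    have fin: "hit m x c \<omega> \<noteq> \<infinity>" using True by auto
    have "exp (- rate m * ?h) * c = x * exp (- delta m * ?h) * exp_mart (eta m) ?h \<omega>"
      using discounted_profit[of ?h x \<omega>] profit_hit[OF w x(2) fin] by (simp only:)
    then have "exp (delta m * ?h) * (exp (- rate m * ?h) * c) =
        exp (delta m * ?h) * (x * exp (- delta m * ?h) * exp_mart (eta m) ?h \<omega>)" by simp
    moreover have "exp (delta m * ?h) * exp (- rate m * ?h) = exp ((delta m - rate m) * ?h)"
      by (simp add: exp_add[symmetric] algebra_simps)
    moreover have "exp (delta m * ?h) * exp (- delta m * ?h) = 1"
      by (simp add: exp_add[symmetric])
    ultimately have "c * exp ((delta m - rate m) * ?h) = x * exp_mart (eta m) ?h \<omega>"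
      by (metis (no_types, lifting) mult.assoc mult.commute mult.right_neutral)
    then show ?thesis using True t w by (simp add: mult_ac)
  next
    case False
    then show ?thesis by simp
  qed
  note os = optional_stopping[where T="hit m x c" and t=t and \<theta>="eta m", OF hit_nonneg hit_stopping t]
  have "(\<integral>\<^sup>+\<omega>. ennreal (flow x c \<omega> t) \<partial>pricing m) =
      (\<integral>\<^sup>+\<omega>. ennreal (x * exp (- delta m * t) * (exp_mart (eta m) t \<omega> * indicator ?U \<omega>)) \<partial>pricing m)"
    by (rule nn_integral_cong) (simp add: 1)
  also have "\<dots> = ennreal (\<integral>\<omega>. x * exp (- delta m * t) * (exp_mart (eta m) t \<omega> * indicator ?U \<omega>) \<partial>pricing m)"
    using x integrable_exp_mart_indicator[OF t U] less_imp_le[OF exp_mart_pos]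
    by (intro nn_integral_eq_integral) auto
  also have "(\<integral>\<omega>. x * exp (- delta m * t) * (exp_mart (eta m) t \<omega> * indicator ?U \<omega>) \<partial>pricing m) =
      (\<integral>\<omega>. x * exp (- delta m * t) * ?S \<omega> \<partial>pricing m)"
    using os by simp
  also have "ennreal \<dots> = (\<integral>\<^sup>+\<omega>. ennreal (x * exp (- delta m * t) * ?S \<omega>) \<partial>pricing m)"
    using x os(1) less_imp_le[OF exp_mart_pos]
    by (intro nn_integral_eq_integral[symmetric]) auto
  also have "\<dots> = (\<integral>\<^sup>+\<omega>. ennreal (indicator {t. 0 \<le> t \<and> hit m x c \<omega> \<le> ereal t} t *
       (c * exp (- delta m * t) * exp ((delta m - rate m) * real_of_ereal (hit m x c \<omega>)))) \<partial>pricing m)"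
    by (rule nn_integral_cong) (simp only: 2)
  finally show ?thesis .
qed

text \<open>Integrability is not known beforehand, so nonnegative integrals are used: the order is
  swapped to replace the profit by its deterministic decay at a fixed time, and swapped back to
  integrate over time path by path.\<close>

lemma
  assumes x: "0 < x" "x \<le> c"
  shows integrable_flow: "integrable (pricing m \<Otimes>\<^sub>M lborel) (\<lambda>z. flow x c (fst z) (snd z))"
    and integral_flow: "(\<integral>z. flow x c (fst z) (snd z) \<partial>(pricing m \<Otimes>\<^sub>M lborel)) =
      (x / c) powr beta m * c / delta m"
proof -
  let ?k = "\<lambda>\<omega> t. indicator {t. 0 \<le> t \<and> hit m x c \<omega> \<le> ereal t} t *
    (c * exp (- delta m * t) * exp ((delta m - rate m) * real_of_ereal (hit m x c \<omega>)))"
  have c: "0 < c" using x by simp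
  note [measurable] = flow_measurable[of x c]
  have k_meas [measurable]: "(\<lambda>z. ?k (fst z) (snd z)) \<in> borel_measurable (pricing m \<Otimes>\<^sub>M lborel)"
  proof -
    have "?k \<omega> t = (if 0 \<le> t \<and> hit m x c \<omega> \<le> ereal t then
        c * exp (- delta m * t) * exp ((delta m - rate m) * real_of_ereal (hit m x c \<omega>)) else 0)" for \<omega> t
      by simp
    then show ?thesis by simp
  qed
  have "(\<integral>\<^sup>+z. ennreal (flow x c (fst z) (snd z)) \<partial>(pricing m \<Otimes>\<^sub>M lborel)) =
      (\<integral>\<^sup>+t. (\<integral>\<^sup>+\<omega>. ennreal (flow x c \<omega> t) \<partial>pricing m) \<partial>lborel)"
    by (subst time.nn_integral_snd[symmetric]) auto
  also have "\<dots> = (\<integral>\<^sup>+t. (\<integral>\<^sup>+\<omega>. ennreal (?k \<omega> t) \<partial>pricing m) \<partial>lborel)"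
  proof (rule nn_integral_cong)
    fix t :: real
    show "(\<integral>\<^sup>+\<omega>. ennreal (flow x c \<omega> t) \<partial>pricing m) = (\<integral>\<^sup>+\<omega>. ennreal (?k \<omega> t) \<partial>pricing m)"
      using nn_integral_flow[OF x, of t] by (cases "0 \<le> t") (auto simp: flow_def)
  qed
  also have "\<dots> = (\<integral>\<^sup>+z. ennreal (?k (fst z) (snd z)) \<partial>(pricing m \<Otimes>\<^sub>M lborel))"
    by (subst time.nn_integral_snd[symmetric]) auto
  also have "\<dots> = (\<integral>\<^sup>+\<omega>. (\<integral>\<^sup>+t. ennreal (?k \<omega> t) \<partial>lborel) \<partial>pricing m)"
    by (subst lborel.nn_integral_fst[symmetric]) auto
  also have "\<dots> = (\<integral>\<^sup>+\<omega>. ennreal (c / delta m * discount m (hit m x c \<omega>)) \<partial>pricing m)"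
  proof (rule nn_integral_cong)
    fix \<omega> assume w: "\<omega> \<in> space (pricing m)"
    show "(\<integral>\<^sup>+t. ennreal (?k \<omega> t) \<partial>lborel) = ennreal (c / delta m * discount m (hit m x c \<omega>))"
      using w
    proof (cases rule: hit_cases[of \<omega> x c])
      case never
      then show ?thesis by (simp add: discount_def)
    next
      case (at h)
      let ?e = "c * exp ((delta m - rate m) * h)"
      have "(\<integral>\<^sup>+t. ennreal (?k \<omega> t) \<partial>lborel) =
          (\<integral>\<^sup>+t. ennreal ?e * ennreal (indicator {h..} t * exp (- delta m * t)) \<partial>lborel)"
        using at c by (intro nn_integral_cong) (auto simp: indicator_def ennreal_mult'[symmetric] mult_ac)
      also have "\<dots> = ennreal ?e * ennreal (exp (- delta m * h) / delta m)"
        by (simp only: nn_integral_exp_atLeast[OF delta_pos, symmetric])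
           (rule nn_integral_cmult, measurable)
      also have "\<dots> = ennreal (?e * (exp (- delta m * h) / delta m))"
        using c delta_pos by (simp add: ennreal_mult'[symmetric])
      \<comment> \<open>The factor \<open>exp ((delta m - rate m) * h)\<close> accumulated up to the
        hit meets the tail \<open>exp (- delta m * h)\<close> and leaves exactly the discount
        factor.\<close>
      also have "?e * (exp (- delta m * h) / delta m) = c / delta m * exp (- rate m * h)"
        by (simp add: exp_add[symmetric] algebra_simps)
      finally show ?thesis using at by (simp add: discount_def)
    qed
  qed
  also have "\<dots> = ennreal (\<integral>\<omega>. c / delta m * discount m (hit m x c \<omega>) \<partial>pricing m)"
    using c delta_pos discount_nonneg integrable_discount_hit[OF x]
    by (intro nn_integral_eq_integral) auto
  finally have nn: "(\<integral>\<^sup>+z. ennreal (flow x c (fst z) (snd z)) \<partial>(pricing m \<Otimes>\<^sub>M lborel)) =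
      ennreal ((x / c) powr beta m * c / delta m)"
    by (simp add: integral_discount_hit[OF x] mult_ac)
  show int: "integrable (pricing m \<Otimes>\<^sub>M lborel) (\<lambda>z. flow x c (fst z) (snd z))"
    using nn flow_nonneg[OF x(1)] by (intro integrableI_nonneg) auto
  have nonneg: "0 \<le> (\<integral>z. flow x c (fst z) (snd z) \<partial>(pricing m \<Otimes>\<^sub>M lborel))"
    by (rule Bochner_Integration.integral_nonneg) (rule flow_nonneg[OF x(1)])
  have "ennreal (\<integral>z. flow x c (fst z) (snd z) \<partial>(pricing m \<Otimes>\<^sub>M lborel)) =
      ennreal ((x / c) powr beta m * c / delta m)"
    using nn nn_integral_eq_integral[OF int] flow_nonneg[OF x(1)] by simp
  then show "(\<integral>z. flow x c (fst z) (snd z) \<partial>(pricing m \<Otimes>\<^sub>M lborel)) =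
      (x / c) powr beta m * c / delta m"
    using c delta_pos nonneg by (subst (asm) ennreal_inj) auto
qed

lemma iterated_flow:
  assumes "0 < x" "x \<le> c"
  shows "integrable (pricing m) (\<lambda>\<omega>. \<integral>t. flow x c \<omega> t \<partial>lborel)"
    and "(\<integral>\<omega>. (\<integral>t. flow x c \<omega> t \<partial>lborel) \<partial>pricing m) = (x / c) powr beta m * c / delta m"
  using time.integrable_fst'[OF integrable_flow[OF assms]]
    time.integral_fst'[OF integrable_flow[OF assms]] integral_flow[OF assms] by auto

section \<open>Closed forms of the pay-offs for arbitrary follower thresholds\<close>

lemma follower_payoff_above:
  assumes x: "0 < x" "x \<le> z"
  shows "follower_payoff m z x = (x / z) powr beta m * (D2 m * z / delta m - cost m)"
proof -
  have "(LINT t:{t. 0 \<le> t \<and> hit m x z \<omega> \<le> ereal t}|lborel. exp (- rate m * t) * (D2 m * profit m x t \<omega>)) =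
      D2 m * (\<integral>t. flow x z \<omega> t \<partial>lborel)" for \<omega>
    unfolding set_lebesgue_integral_def integral_mult_right_zero[symmetric]
    by (rule Bochner_Integration.integral_cong) (auto simp: flow_def)
  then have "follower_payoff m z x =
      (\<integral>\<omega>. D2 m * (\<integral>t. flow x z \<omega> t \<partial>lborel) - discount m (hit m x z \<omega>) * cost m \<partial>pricing m)"
    unfolding follower_payoff_def by simp
  also have "\<dots> = D2 m * ((x / z) powr beta m * z / delta m) - (x / z) powr beta m * cost m"
    using iterated_flow[OF x] integrable_discount_hit[OF x] integral_discount_hit[OF x] by simp
  finally show ?thesis by (simp add: algebra_simps)
qed

lemma follower_payoff_below:
  assumes x: "0 < x" "z \<le> x"
  shows "follower_payoff m z x = D2 m * x / delta m - cost m"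
proof -
  have "follower_payoff m z x = follower_payoff m x x"
    unfolding follower_payoff_def
    by (rule Bochner_Integration.integral_cong) (auto simp: hit_eq_0 x)
  then show ?thesis using follower_payoff_above[of x x] x by simp
qed

text \<open>The leader's stream is the full one at rate \<open>D1 m\<close> minus the loss
  \<open>D1 m - D2 m\<close> from the follower's entry on; \<open>flow x x\<close> is the full
  stream because its hitting time is 0.\<close>

lemma leader_payoff_above:
  assumes x: "0 < x" "x \<le> z"
  shows "leader_payoff m z x =
    D1 m * x / delta m - (D1 m - D2 m) * ((x / z) powr beta m * z / delta m) - cost m"
proof -
  note f = integrable_flow[OF x(1) order_refl] integrable_flow[OF x]
  let ?g = "\<lambda>\<omega> t. D1 m * flow x x \<omega> t - (D1 m - D2 m) * flow x z \<omega> t"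
  have g: "integrable (pricing m \<Otimes>\<^sub>M lborel) (\<lambda>p. ?g (fst p) (snd p))"
    using f by simp
  have "leader_payoff m z x = (\<integral>\<omega>. (\<integral>t. ?g \<omega> t \<partial>lborel) \<partial>pricing m) - cost m"
    unfolding leader_payoff_def set_lebesgue_integral_def
  proof (intro arg_cong2[where f="(-)"] Bochner_Integration.integral_cong refl)
    fix \<omega> t assume "\<omega> \<in> space (pricing m)"
    then have "hit m x x \<omega> = 0" by (rule hit_eq_0) simp
    then show "indicator {0..} t *\<^sub>R (exp (- rate m * t) *
        ((if ereal t < hit m x z \<omega> then D1 m else D2 m) * profit m x t \<omega>)) = ?g \<omega> t"
      by (cases "0 \<le> t"; cases "hit m x z \<omega> \<le> ereal t")
         (simp_all add: flow_def not_le[symmetric] left_diff_distrib)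
  qed
  also have "(\<integral>\<omega>. (\<integral>t. ?g \<omega> t \<partial>lborel) \<partial>pricing m) =
      (\<integral>p. ?g (fst p) (snd p) \<partial>(pricing m \<Otimes>\<^sub>M lborel))"
    using time.integral_fst'[OF g] by simp
  also have "\<dots> = D1 m * x / delta m - (D1 m - D2 m) * ((x / z) powr beta m * z / delta m)"
    using f x integral_flow[OF x] integral_flow[OF x(1) order_refl] by simp
  finally show ?thesis .
qed

lemma leader_payoff_below:
  assumes x: "0 < x" "z \<le> x"
  shows "leader_payoff m z x = D2 m * x / delta m - cost m"
proof -
  have "leader_payoff m z x = leader_payoff m x x"
    unfolding leader_payoff_def set_lebesgue_integral_def
    by (intro arg_cong2[where f="(-)"] Bochner_Integration.integral_cong refl) (auto simp: hit_eq_0 x)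
  then show ?thesis using leader_payoff_above[of x x] x by (simp add: algebra_simps diff_divide_distrib)
qed

lemma joint_payoff_eq:
  assumes x: "0 < x"
  shows "joint_payoff m x = joint_value m x"
proof -
  have "joint_payoff m x = leader_payoff m x x"
    unfolding leader_payoff_def joint_payoff_def set_lebesgue_integral_def
    by (intro arg_cong2[where f="(-)"] Bochner_Integration.integral_cong refl)
       (auto simp: hit_eq_0 x indicator_def)
  then show ?thesis using leader_payoff_below[OF x order_refl] by (simp add: joint_value_def)
qed

lemma YF_div_delta: "YF m / delta m = cost m * beta m / (beta m - 1) / D2 m"
  using delta_pos D2_pos beta_gt_1 by (simp add: YF_def field_simps)

lemma leader_payoff_eq:
  assumes x: "0 < x"
  shows "leader_payoff m (YF m) x = leader_value m x"
proof (cases "x < YF m")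
  case True
  have "(D1 m - D2 m) * ((x / YF m) powr beta m * YF m / delta m) =
      (D1 m - D2 m) * (x / YF m) powr beta m * (YF m / delta m)" by simp
  also have "\<dots> = (D1 m - D2 m) / D2 m * (cost m * beta m / (beta m - 1)) * (x / YF m) powr beta m"
    unfolding YF_div_delta by (simp add: mult_ac)
  finally show ?thesis
    using leader_payoff_above[OF x less_imp_le[OF True]] True by (simp add: leader_value_def)
next
  case False
  then show ?thesis using leader_payoff_below[OF x, of "YF m"] by (simp add: leader_value_def)
qed

end

section \<open>Value functions\<close>

text \<open>Strict convexity: the expression is the distance of the power from its tangent at 1. It
  yields the optimality of \<open>YF m\<close>, the comparison of joint investment with following,
  and the monotone chord slope.\<close>

lemma powr_above_tangent_at_1:
  fixes b :: real
  assumes b: "1 < b" and w: "0 < w" "w \<noteq> 1"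
  shows "0 < w powr b - b * w + (b - 1)"
proof -
  let ?f = "\<lambda>w::real. w powr b - b * w + (b - 1)"
  have der: "(?f has_real_derivative b * (v powr (b - 1) - 1)) (at v)" if "0 < v" for v
    using that b by (auto intro!: derivative_eq_intros simp: algebra_simps)
  have cont: "continuous_on {u..v} ?f" if "0 < u" for u v
    using that by (intro continuous_intros) auto
  show ?thesis
  proof (cases "1 < w")
    case True
    have "?f 1 < ?f w"
    proof (rule DERIV_pos_imp_increasing_open[OF True _ cont])
      fix v :: real assume v: "1 < v"
      then have "1 < v powr (b - 1)" using b by (intro gr_one_powr) auto
      then have "0 < b * (v powr (b - 1) - 1)" using b by simp
      then show "\<exists>y. (?f has_real_derivative y) (at v) \<and> 0 < y" using der[of v] v by force
    qed simp
    then show ?thesis by simp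
  next
    case False
    then have w1: "w < 1" using w by simp
    have "?f 1 < ?f w"
    proof (rule DERIV_neg_imp_decreasing_open[OF w1 _ cont[OF w(1)]])
      fix v assume v: "w < v" "v < 1"
      then have "v powr (b - 1) < 1 powr (b - 1)" using b w by (intro powr_less_mono2) auto
      then have "b * (v powr (b - 1) - 1) < 0" using b by (simp add: mult_pos_neg)
      then show "\<exists>y. (?f has_real_derivative y) (at v) \<and> y < 0" using der[of v] v w by force
    qed
    then show ?thesis by simp
  qed
qed

text \<open>Up to a positive factor, the derivative of the slope of the chord to
  \<open>(1, 1)\<close> is the distance from the tangent evaluated at \<open>1 / w\<close>.\<close>

lemma powr_chord_slope_increasing:
  fixes b :: real
  assumes b: "1 < b" and u: "0 < u" "u < v" "v < 1"
  shows "(1 - u powr b) / (1 - u) < (1 - v powr b) / (1 - v)"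
proof (rule DERIV_pos_imp_increasing[OF u(2)])
  fix w assume w: "u \<le> w" "w \<le> v"
  then have w01: "0 < w" "w < 1" using u by auto
  let ?d = "(- (b * w powr (b - 1)) * (1 - w) + (1 - w powr b)) / (1 - w)\<^sup>2"
  have "((\<lambda>w. (1 - w powr b) / (1 - w)) has_real_derivative ?d) (at w)"
    using w01 by (auto intro!: derivative_eq_intros simp: power2_eq_square field_simps)
  moreover have "0 < ?d"
  proof -
    have "0 < w powr b * ((1 / w) powr b - b * (1 / w) + (b - 1))"
      using powr_above_tangent_at_1[OF b, of "1 / w"] w01 by simp
    also have "\<dots> = - (b * w powr (b - 1)) * (1 - w) + (1 - w powr b)"
      using w01 by (simp add: powr_divide powr_diff field_simps)
    finally show ?thesis using w01 by simp
  qed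
  ultimately show "\<exists>y. ((\<lambda>w. (1 - w powr b) / (1 - w)) has_real_derivative y) (at w) \<and> 0 < y" by blast
qed

section \<open>Value functions as functions of the level relative to the threshold\<close>

context market
begin

text \<open>The follower's value at \<open>YF m\<close>. Divided by it, the joint value and, up to
  \<open>YF m\<close>, the follower's value depend only on \<open>y / YF m\<close> and
  \<open>beta m\<close>.\<close>

definition unit_gain :: real where "unit_gain = cost m / (beta m - 1)"

lemma unit_gain_pos: "0 < unit_gain"
  using cost_pos beta_gt_1 by (simp add: unit_gain_def)

lemma cost_eq: "cost m = unit_gain * (beta m - 1)"
  using beta_gt_1 by (simp add: unit_gain_def)

lemma revenue_eq: "D2 m * y / delta m = unit_gain * (beta m * (y / YF m))"
proof -
  have "D2 m * y / delta m = D2 m * (YF m / delta m) * (y / YF m)" using YF_pos by simp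
  also have "D2 m * (YF m / delta m) = unit_gain * beta m"
    unfolding YF_div_delta using D2_pos by (simp add: unit_gain_def)
  finally show ?thesis by simp
qed

lemma joint_value_eq: "joint_value m y = unit_gain * (beta m * (y / YF m) - (beta m - 1))"
  using cost_eq unfolding joint_value_def revenue_eq by (simp only: right_diff_distrib)

lemma follower_value_low: "y \<le> YF m \<Longrightarrow> follower_value m y = unit_gain * (y / YF m) powr beta m"
  by (simp add: follower_value_def unit_gain_def)

lemma follower_value_high:
  assumes "YF m \<le> y"
  shows "follower_value m y = joint_value m y"
proof (cases "y = YF m")
  case True
  then show ?thesis using YF_pos by (simp add: follower_value_low joint_value_eq)
next
  case False
  then show ?thesis using assms by (simp add: follower_value_def joint_value_def)
qed

lemma leader_value_high: "YF m \<le> y \<Longrightarrow> leader_value m y = joint_value m y"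
  by (simp add: leader_value_def joint_value_def)

lemma leader_minus_joint:
  assumes "y < YF m"
  shows "leader_value m y - joint_value m y =
    (D1 m - D2 m) / D2 m * unit_gain * beta m * (y / YF m - (y / YF m) powr beta m)"
proof -
  have "D1 m * y / delta m - D2 m * y / delta m = (D1 m - D2 m) / D2 m * (D2 m * y / delta m)"
    using D2_pos by (simp add: left_diff_distrib diff_divide_distrib)
  also have "\<dots> = (D1 m - D2 m) / D2 m * unit_gain * beta m * (y / YF m)"
    unfolding revenue_eq by simp
  finally have rev: "D1 m * y / delta m - D2 m * y / delta m =
      (D1 m - D2 m) / D2 m * unit_gain * beta m * (y / YF m)" .
  have "(D1 m - D2 m) / D2 m * (cost m * beta m / (beta m - 1)) * (y / YF m) powr beta m =
      (D1 m - D2 m) / D2 m * unit_gain * beta m * (y / YF m) powr beta m"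
    by (simp add: unit_gain_def)
  then show ?thesis
    using assms rev unfolding leader_value_def joint_value_def right_diff_distrib by simp
qed

lemma follower_minus_joint:
  assumes "y \<le> YF m"
  shows "follower_value m y - joint_value m y =
    unit_gain * ((y / YF m) powr beta m - beta m * (y / YF m) + (beta m - 1))"
  unfolding follower_value_low[OF assms] joint_value_eq by (simp only: right_diff_distrib distrib_left)

lemma tangent_nonneg:
  assumes "0 < v"
  shows "0 \<le> v powr beta m - beta m * v + (beta m - 1)"
  using powr_above_tangent_at_1[OF beta_gt_1 assms] by (cases "v = 1") auto

lemma joint_le_follower:
  assumes "0 < y"
  shows "joint_value m y \<le> follower_value m y"
proof (cases "y \<le> YF m")
  case True
  have "0 \<le> unit_gain * ((y / YF m) powr beta m - beta m * (y / YF m) + (beta m - 1))"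
    using tangent_nonneg[of "y / YF m"] unit_gain_pos assms YF_pos by (intro mult_nonneg_nonneg) auto
  then show ?thesis using follower_minus_joint[OF True] by simp
next
  case False
  then show ?thesis by (simp add: follower_value_high)
qed

lemma joint_less_leader:
  assumes "0 < y" "y < YF m"
  shows "joint_value m y < leader_value m y"
proof -
  have "(y / YF m) powr beta m < (y / YF m) powr 1"
    using assms beta_gt_1 by (intro powr_less_mono') auto
  then have "0 < (D1 m - D2 m) / D2 m * unit_gain * beta m * (y / YF m - (y / YF m) powr beta m)"
    using assms D2_pos D2_less_D1 unit_gain_pos beta_gt_1 by (intro mult_pos_pos) auto
  then show ?thesis using leader_minus_joint[OF assms(2)] by simp
qed

lemma follower_payoff_YF:
  assumes "0 < y"
  shows "follower_payoff m (YF m) y = follower_value m y"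
proof (cases "y \<le> YF m")
  case True
  have "D2 m * YF m / delta m - cost m = unit_gain"
    using joint_value_eq[of "YF m"] YF_pos by (simp add: joint_value_def algebra_simps)
  then show ?thesis
    using follower_payoff_above[OF assms True] True by (simp add: follower_value_low mult_ac)
next
  case False
  then show ?thesis
    using follower_payoff_below[OF assms, of "YF m"] by (simp add: follower_value_def)
qed

text \<open>In units of \<open>unit_gain\<close> the joint value is the tangent at 1 to the power
  that gives the follower's value up to \<open>YF m\<close>. Waiting for \<open>v\<close> discounts
  a value on the tangent, at most \<open>v powr beta m\<close>, by
  \<open>(u / v) powr beta m\<close>, hence cannot beat \<open>u powr beta m\<close>.\<close>

lemma follower_payoff_le:
  assumes y: "0 < y"
  shows "follower_payoff m z y \<le> follower_value m y"
proof (cases "z \<le> y")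
  case True
  then show ?thesis
    using follower_payoff_below[OF y] joint_le_follower[OF y] by (simp add: joint_value_def)
next
  case False
  then have yz: "y < z" by simp
  define u v where "u = y / YF m" and "v = z / YF m"
  have uv: "0 < u" "u < v" using y yz YF_pos by (auto simp: u_def v_def divide_strict_right_mono)
  have e: "follower_payoff m z y = unit_gain * ((u / v) powr beta m * (beta m * v - (beta m - 1)))"
    using follower_payoff_above[OF y less_imp_le[OF yz]] joint_value_eq[of z] y yz YF_pos
    by (simp add: joint_value_def u_def v_def)
  show ?thesis
  proof (cases "y \<le> YF m")
    case True
    have "(u / v) powr beta m * (beta m * v - (beta m - 1)) \<le> (u / v) powr beta m * v powr beta m"
      using tangent_nonneg[of v] uv by (intro mult_left_mono) auto
    also have "\<dots> = u powr beta m" using uv by (simp add: powr_divide)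
    finally show ?thesis
      using unit_gain_pos unfolding e follower_value_low[OF True] u_def[symmetric]
      by (intro mult_left_mono) auto
  next
    case False
    \<comment> \<open>Above \<open>YF m\<close> waiting has to lose to immediate investment. At
      \<open>u = 1\<close> this is the tangent inequality at \<open>1 / r\<close>; a larger
      \<open>u\<close> adds a multiple of the nonnegative
      \<open>beta m * (1 - r powr (beta m - 1))\<close>.\<close>
    define r where "r = u / v"
    have r: "0 < r" "r < 1" using uv by (auto simp: r_def)
    have u1: "1 \<le> u" using False YF_pos by (simp add: u_def)
    have vr: "v = u / r" using uv by (simp add: r_def)
    have "0 \<le> r powr beta m * ((1 / r) powr beta m - beta m * (1 / r) + (beta m - 1))"
      using tangent_nonneg[of "1 / r"] r by simp
    also have "\<dots> = 1 - beta m * r powr (beta m - 1) + (beta m - 1) * r powr beta m"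
      using r by (simp add: powr_divide powr_diff field_simps)
    finally have t: "0 \<le> 1 - beta m * r powr (beta m - 1) + (beta m - 1) * r powr beta m" .
    have "r powr (beta m - 1) \<le> 1" using r beta_gt_1 by (simp add: powr_le1)
    then have "1 * (beta m * (1 - r powr (beta m - 1))) \<le> u * (beta m * (1 - r powr (beta m - 1)))"
      using u1 beta_gt_1 by (intro mult_right_mono) auto
    then have "u * (beta m * r powr (beta m - 1)) - (beta m - 1) * r powr beta m
        \<le> beta m * u - (beta m - 1)"
      using t by (simp add: algebra_simps)
    moreover have "r powr beta m * (beta m * v - (beta m - 1)) =
        u * (beta m * r powr (beta m - 1)) - (beta m - 1) * r powr beta m"
      using r unfolding vr by (simp add: powr_diff field_simps)
    ultimately have "r powr beta m * (beta m * v - (beta m - 1)) \<le> beta m * u - (beta m - 1)" by simp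
    then have "follower_payoff m z y \<le> unit_gain * (beta m * u - (beta m - 1))"
      using unit_gain_pos unfolding e r_def[symmetric] by (intro mult_left_mono) auto
    then show ?thesis using False by (simp add: follower_value_high joint_value_eq u_def)
  qed
qed

text \<open>Up to \<open>YF m\<close> the follower's value is homogeneous of degree
  \<open>beta m\<close>, the exponent of the expected discount factor. Collecting it at a different
  level therefore changes nothing.\<close>

lemma follower_value_scale:
  assumes "0 < y" "y \<le> x" "x \<le> YF m"
  shows "(y / x) powr beta m * follower_value m x = follower_value m y"
  using assms YF_pos by (simp add: follower_value_low powr_divide)

text \<open>\<open>p0\<close> is its complement to 1, and the sign of the comparison between
  regulation and following depends on the level through it alone.\<close>

definition gap_ratio :: "real \<Rightarrow> real" where
  "gap_ratio y = (follower_value m y - joint_value m y) / (leader_value m y - joint_value m y)"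

text \<open>Dividing numerator and denominator by \<open>1 - u\<close> with
  \<open>u = y / YF m\<close> leaves the chord slope of the power as the only place where the level
  enters.\<close>

lemma gap_ratio_eq:
  assumes "0 < y" "y < YF m"
  shows "gap_ratio y = D2 m / ((D1 m - D2 m) * beta m) *
    ((beta m - 1) / ((1 - (y / YF m) powr beta m) / (1 - y / YF m) - 1) - 1)"
proof -
  define u where "u = y / YF m"
  define w where "w = u powr beta m"
  have u: "0 < u" "u < 1" using assms YF_pos by (auto simp: u_def)
  have "u powr beta m < u powr 1" using u beta_gt_1 by (intro powr_less_mono') auto
  then have w: "w < u" using u by (simp add: w_def)
  have "(1 - w) / (1 - u) - 1 = (u - w) / (1 - u)" using u by (simp add: field_simps)
  then have "(beta m - 1) / ((1 - w) / (1 - u) - 1) - 1 = (beta m - 1) * (1 - u) / (u - w) - 1" by simp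
  also have "\<dots> = (w - beta m * u + (beta m - 1)) / (u - w)" using w by (simp add: field_simps)
  finally have 1: "(beta m - 1) / ((1 - w) / (1 - u) - 1) - 1 = (w - beta m * u + (beta m - 1)) / (u - w)" .
  have "gap_ratio y = unit_gain * (w - beta m * u + (beta m - 1)) /
      ((D1 m - D2 m) / D2 m * unit_gain * beta m * (u - w))"
    using assms unfolding gap_ratio_def u_def w_def
    by (simp only: follower_minus_joint[OF less_imp_le] leader_minus_joint)
  also have "\<dots> = (unit_gain * (w - beta m * u + (beta m - 1))) /
      (unit_gain * ((D1 m - D2 m) / D2 m * beta m * (u - w)))" by (simp only: mult_ac)
  also have "\<dots> = (w - beta m * u + (beta m - 1)) / ((D1 m - D2 m) / D2 m * beta m * (u - w))"
    using unit_gain_pos by (intro mult_divide_mult_cancel_left) simp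
  also have "\<dots> = D2 m / ((D1 m - D2 m) * beta m) * ((w - beta m * u + (beta m - 1)) / (u - w))"
    using D2_pos by simp
  finally show ?thesis unfolding 1[symmetric] by (simp add: u_def w_def)
qed

lemma gap_ratio_decreasing:
  assumes "0 < x" "x < y" "y < YF m"
  shows "gap_ratio y < gap_ratio x"
proof -
  define k where "k y = (1 - (y / YF m) powr beta m) / (1 - y / YF m)" for y
  have x1: "1 < k x"
  proof -
    have "(x / YF m) powr beta m < (x / YF m) powr 1"
      using assms beta_gt_1 by (intro powr_less_mono') auto
    then show ?thesis using assms by (simp add: k_def)
  qed
  have "k x < k y" unfolding k_def
    using assms YF_pos beta_gt_1
    by (intro powr_chord_slope_increasing) (auto simp: divide_strict_right_mono)
  then have "(beta m - 1) / (k y - 1) < (beta m - 1) / (k x - 1)"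
    using x1 beta_gt_1 by (intro divide_strict_left_mono mult_pos_pos) auto
  then have "D2 m / ((D1 m - D2 m) * beta m) * ((beta m - 1) / (k y - 1) - 1)
      < D2 m / ((D1 m - D2 m) * beta m) * ((beta m - 1) / (k x - 1) - 1)"
    using D2_pos D2_less_D1 beta_gt_1 by (intro mult_strict_left_mono) auto
  then show ?thesis using assms by (simp add: gap_ratio_eq k_def)
qed

lemma p0_eq: "0 < y \<Longrightarrow> y < YF m \<Longrightarrow> p0 m y = 1 - gap_ratio y"
  using joint_less_leader[of y] by (simp add: p0_def gap_ratio_def diff_divide_distrib[symmetric] field_simps)

text \<open>Needed for the limits at \<open>YL\<close>. \<open>leader_value\<close> changes formula
  only at \<open>YF m\<close>, so near \<open>y\<close> the closed forms hold.\<close>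

lemma isCont_p0:
  assumes y: "0 < y" "y < YF m"
  shows "isCont (p0 m) y"
proof -
  let ?L = "\<lambda>y. joint_value m y + (D1 m - D2 m) / D2 m * unit_gain * beta m * (y / YF m - (y / YF m) powr beta m)"
  let ?F = "\<lambda>y. unit_gain * (y / YF m) powr beta m"
  let ?g = "\<lambda>y. (?L y - ?F y) / (?L y - joint_value m y)"
  have L: "leader_value m x = ?L x" if "x < YF m" for x using leader_minus_joint[OF that] by simp
  have w: "isCont (\<lambda>x. (x / YF m) powr beta m) y"
    using y YF_pos by (intro continuous_intros) auto
  have J: "isCont (joint_value m) y"
    unfolding joint_value_eq by (intro continuous_intros) (use YF_pos in auto)
  have L': "isCont ?L y"
    by (intro continuous_intros J w) (use YF_pos in auto)
  have "isCont ?F y" by (intro continuous_intros w)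
  then have g: "isCont ?g y"
    by (rule isCont_divide[OF isCont_diff[OF L'] isCont_diff[OF L' J]])
       (use joint_less_leader[OF y] L[OF y(2)] in linarith)
  have ev: "\<forall>\<^sub>F x in nhds y. p0 m x = ?g x"
  proof (rule eventually_nhds_in_open[of "{..<YF m}", THEN eventually_mono])
    fix x assume "x \<in> {..<YF m}"
    then show "p0 m x = ?g x"
      unfolding p0_def using L[of x] follower_value_low[of x] by (simp only: lessThan_iff less_imp_le)
  qed (use y in auto)
  from isCont_cong[OF ev] g show ?thesis by (rule iffD2)
qed

end

section \<open>The coordination game\<close>

lemma other_other [simp]: "other (other i) = i"
  by (cases i) auto

lemma other_neq [simp]: "other i \<noteq> i" "i \<noteq> other i"
  by (cases i; simp)+

lemma all_agents: "(\<forall>i. P i) \<longleftrightarrow> P Agent1 \<and> P Agent2"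
  by (metis agent.exhaust)

lemma ex_agent: "(\<exists>i. P i) \<longleftrightarrow> P Agent1 \<or> P Agent2"
  by (metis agent.exhaust)

lemma defer_less_1:
  fixes p :: "agent \<Rightarrow> real"
  assumes p: "\<And>j. 0 \<le> p j" "\<And>j. p j \<le> 1" and pos: "0 < max (p Agent1) (p Agent2)"
  shows "0 \<le> (1 - p Agent1) * (1 - p Agent2)" "(1 - p Agent1) * (1 - p Agent2) < 1"
proof -
  show "0 \<le> (1 - p Agent1) * (1 - p Agent2)" using p by simp
  have "0 < p Agent1 \<or> 0 < p Agent2" using pos by (auto simp: max_def split: if_splits)
  then show "(1 - p Agent1) * (1 - p Agent2) < 1"
  proof
    assume "0 < p Agent1"
    then have "(1 - p Agent1) * 1 < 1" by simp
    moreover have "(1 - p Agent1) * (1 - p Agent2) \<le> (1 - p Agent1) * 1"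
      using p by (intro mult_left_mono) auto
    ultimately show ?thesis by (rule le_less_trans[rotated])
  next
    assume "0 < p Agent2"
    then have "1 * (1 - p Agent2) < 1" by simp
    moreover have "(1 - p Agent1) * (1 - p Agent2) \<le> 1 * (1 - p Agent2)"
      using p by (intro mult_right_mono) auto
    ultimately show ?thesis by (rule le_less_trans[rotated])
  qed
qed

lemma
  fixes p :: "agent \<Rightarrow> real"
  assumes p: "\<And>j. 0 \<le> p j" "\<And>j. p j \<le> 1" and pos: "0 < max (p Agent1) (p Agent2)"
  shows sole_prob_eq: "sole_prob p i = p i * (1 - p (other i)) / (1 - (1 - p Agent1) * (1 - p Agent2))"
    and both_prob_eq: "both_prob p = p Agent1 * p Agent2 / (1 - (1 - p Agent1) * (1 - p Agent2))"
proof -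
  let ?c = "(1 - p Agent1) * (1 - p Agent2)"
  have c: "norm ?c < 1" using defer_less_1[OF p pos] by simp
  have "(\<Sum>k. ?c ^ k * a) = a / (1 - ?c)" for a
    using suminf_mult2[OF summable_geometric[OF c], of a] suminf_geometric[OF c] by simp
  then show "sole_prob p i = p i * (1 - p (other i)) / (1 - ?c)"
    "both_prob p = p Agent1 * p Agent2 / (1 - ?c)"
    unfolding sole_prob_def both_prob_def by auto
qed

lemma sole_prob_0: "p i = 0 \<Longrightarrow> sole_prob p i = 0"
  by (simp add: sole_prob_def)

lemma both_prob_0: "p i = 0 \<Longrightarrow> both_prob p = 0"
  by (cases i) (simp_all add: both_prob_def)

lemma prob_nonneg:
  fixes p :: "agent \<Rightarrow> real"
  assumes p: "\<And>j. 0 \<le> p j" "\<And>j. p j \<le> 1"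
  shows "0 \<le> sole_prob p i" "0 \<le> both_prob p"
proof -
  have "0 \<le> sole_prob p i \<and> 0 \<le> both_prob p"
  proof (cases "0 < max (p Agent1) (p Agent2)")
    case True
    then show ?thesis
      using sole_prob_eq[OF p True, of i] both_prob_eq[OF p True] defer_less_1[OF p True] p by simp
  next
    case False
    then have "p Agent1 = 0" "p Agent2 = 0" using p[of Agent1] p[of Agent2] by auto
    then have "p j = 0" for j by (cases j) auto
    then show ?thesis by (simp add: sole_prob_0 both_prob_0)
  qed
  then show "0 \<le> sole_prob p i" "0 \<le> both_prob p" by auto
qed

lemma prob_total:
  fixes p :: "agent \<Rightarrow> real"
  assumes p: "\<And>j. 0 \<le> p j" "\<And>j. p j \<le> 1" and pos: "0 < max (p Agent1) (p Agent2)"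
  shows "sole_prob p Agent1 + sole_prob p Agent2 + both_prob p = 1"
proof -
  let ?d = "1 - (1 - p Agent1) * (1 - p Agent2)"
  have d: "?d \<noteq> 0" using defer_less_1[OF p pos] by simp
  have "p Agent1 * (1 - p Agent2) + p Agent2 * (1 - p Agent1) + p Agent1 * p Agent2 = ?d"
    by (simp add: algebra_simps)
  then show ?thesis
    unfolding sole_prob_eq[OF p pos] both_prob_eq[OF p pos] add_divide_distrib[symmetric]
    using d by simp
qed

text \<open>In the degenerate case \<open>ends\<close> ensures that \<open>Lim\<close> is a true
  limit, so signs and total mass pass to it; otherwise the geometric series converges.\<close>

lemma outcome_at:
  fixes s :: "agent \<Rightarrow> strategy"
  assumes e: "\<And>j y. 0 \<le> exer (s j) y" "\<And>j y. exer (s j) y \<le> 1" and ends: "ends s y"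
  shows "0 \<le> sole_at s y i" "0 \<le> both_at s y"
    and "sole_at s y i + sole_at s y (other i) + both_at s y = 1"
proof -
  have "(\<forall>i. 0 \<le> sole_at s y i) \<and> 0 \<le> both_at s y \<and>
      sole_at s y Agent1 + sole_at s y Agent2 + both_at s y = 1"
  proof (cases "0 < max (exer (s Agent1) y) (exer (s Agent2) y)")
    case True
    then show ?thesis
      unfolding sole_at_def both_at_def
      using prob_nonneg[of "\<lambda>j. exer (s j) y", OF e] prob_total[of "\<lambda>j. exer (s j) y", OF e True]
      by simp
  next
    case False
    with ends obtain a1 a2 b where lim:
      "((\<lambda>x. sole_prob (\<lambda>j. exer (s j) x) Agent1) \<longlongrightarrow> a1) (at_right y)"
      "((\<lambda>x. sole_prob (\<lambda>j. exer (s j) x) Agent2) \<longlongrightarrow> a2) (at_right y)"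
      "((\<lambda>x. both_prob (\<lambda>j. exer (s j) x)) \<longlongrightarrow> b) (at_right y)" and sum: "a1 + a2 + b = 1"
      unfolding ends_def by blast
    have nt: "\<not> trivial_limit (at_right y)" by simp
    have val: "sole_at s y Agent1 = a1" "sole_at s y Agent2 = a2" "both_at s y = b"
      unfolding sole_at_def both_at_def using False lim[THEN tendsto_Lim[OF nt]] by auto
    have "0 \<le> a1" "0 \<le> a2" "0 \<le> b"
      by (rule tendsto_lowerbound[OF lim(1) _ nt] tendsto_lowerbound[OF lim(2) _ nt]
          tendsto_lowerbound[OF lim(3) _ nt], rule always_eventually, rule allI, rule prob_nonneg[OF e])+
    then show ?thesis using val sum by (simp add: all_agents)
  qed
  then show "0 \<le> sole_at s y i" "0 \<le> both_at s y"
    "sole_at s y i + sole_at s y (other i) + both_at s y = 1"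
    by (cases i; simp)+
qed

text \<open>Inactivity of the opponent at \<open>y\<close> alone would not suffice: if the agent's
  own probability vanishes there, the outcome is a limit from above. Hence the interval to the right
  of \<open>y\<close>.\<close>

lemma sole_mover:
  fixes s :: "agent \<Rightarrow> strategy"
  assumes e: "\<And>j y. 0 \<le> exer (s j) y" "\<And>j y. exer (s j) y \<le> 1" and ends: "ends s y"
    and inactive: "\<And>x. y \<le> x \<Longrightarrow> x < y' \<Longrightarrow> exer (s (other i)) x = 0" and y': "y < y'"
  shows "sole_at s y i = 1" "sole_at s y (other i) = 0" "both_at s y = 0"
proof -
  have z: "sole_prob (\<lambda>j. exer (s j) x) (other i) = 0" "both_prob (\<lambda>j. exer (s j) x) = 0"
    if "y \<le> x" "x < y'" for x
    using inactive[OF that] sole_prob_0[of "\<lambda>j. exer (s j) x" "other i"]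
      both_prob_0[of "\<lambda>j. exer (s j) x" "other i"] by auto
  have ev: "\<forall>\<^sub>F x in at_right y. y \<le> x \<and> x < y'"
    using y' eventually_at_right_less[of y] eventually_at_right[OF y', of "\<lambda>x. x < y'"]
    by (auto elim: eventually_elim2 intro: less_imp_le)
  have lim: "((\<lambda>x. sole_prob (\<lambda>j. exer (s j) x) (other i)) \<longlongrightarrow> 0) (at_right y)"
    "((\<lambda>x. both_prob (\<lambda>j. exer (s j) x)) \<longlongrightarrow> 0) (at_right y)"
    by (rule tendsto_eventually, rule eventually_mono[OF ev], use z in blast)+
  show s0: "sole_at s y (other i) = 0"
    unfolding sole_at_def using z[OF order_refl y'] tendsto_Lim[OF _ lim(1)] by simp
  show b0: "both_at s y = 0"
    unfolding both_at_def using z[OF order_refl y'] tendsto_Lim[OF _ lim(2)] by simp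
  show "sole_at s y i = 1" using outcome_at(3)[where s=s, OF e ends, of i] s0 b0 by simp
qed

section \<open>Reduction of sub-game pay-offs to the level of the call\<close>

context market
begin

lemma call_time_eq:
  assumes w: "\<omega> \<in> space (pricing m)"
  shows "call_time m s y \<omega> = hit m y (min (wait (s Agent1)) (wait (s Agent2))) \<omega>"
proof -
  let ?c = "min (wait (s Agent1)) (wait (s Agent2))"
  have "{t. 0 \<le> t \<and> (\<exists>i. G m y (wait (s i)) t \<omega> = 1)} = {t. 0 \<le> t \<and> hit m y ?c \<omega> \<le> ereal t}"
  proof (intro Collect_cong conj_cong refl)
    fix t :: real assume t: "0 \<le> t"
    have "(\<exists>i. G m y (wait (s i)) t \<omega> = 1) \<longleftrightarrow> (\<exists>i. \<exists>u\<in>{0..t}. wait (s i) \<le> profit m y u \<omega>)"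
      by (simp add: G_def hit_le_iff[OF w t])
    also have "\<dots> \<longleftrightarrow> (\<exists>u\<in>{0..t}. ?c \<le> profit m y u \<omega>)"
      unfolding ex_agent min_le_iff_disj by blast
    finally show "(\<exists>i. G m y (wait (s i)) t \<omega> = 1) \<longleftrightarrow> hit m y ?c \<omega> \<le> ereal t"
      by (simp add: hit_le_iff[OF w t])
  qed
  then have ct: "call_time m s y \<omega> = (INF t\<in>{t. 0 \<le> t \<and> hit m y ?c \<omega> \<le> ereal t}. ereal t)"
    unfolding call_time_def by simp
  show ?thesis
    using w
  proof (cases rule: hit_cases[of \<omega> y ?c])
    case never
    then show ?thesis unfolding ct by (simp add: top_ereal_def)
  next
    case (at h)
    then show ?thesis unfolding ct by (intro antisym INF_lower2[of h] INF_greatest) auto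
  qed
qed

lemma hit_max:
  assumes "\<omega> \<in> space (pricing m)"
  shows "hit m y (max y c) \<omega> = hit m y c \<omega>"
  using hit_eq_0[OF assms, of c y] hit_eq_0[OF assms, of y y] by (cases "c \<le> y") (auto simp: max_def)

text \<open>The call comes when the lower waiting threshold is reached, at once if the start is
  above it. By continuity the profit is then exactly \<open>x\<close>, so the game pay-off is a
  constant and only the discount factor is averaged.\<close>

lemma payoff_eq:
  fixes s :: "agent \<Rightarrow> strategy"
  assumes y: "0 < y"
  defines "x \<equiv> max y (min (wait (s Agent1)) (wait (s Agent2)))"
  shows "payoff m s i y = (y / x) powr beta m * game_payoff m s i x"
proof -
  have x: "y \<le> x" by (simp add: x_def)
  have "payoff m s i y = (\<integral>\<omega>. discount m (hit m y x \<omega>) * game_payoff m s i x \<partial>pricing m)"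
    unfolding payoff_def Let_def
  proof (rule Bochner_Integration.integral_cong[OF refl])
    fix \<omega> assume w: "\<omega> \<in> space (pricing m)"
    have ct: "call_time m s y \<omega> = hit m y x \<omega>"
      unfolding x_def hit_max[OF w] by (rule call_time_eq[OF w])
    show "discount m (call_time m s y \<omega>) *
        game_payoff m s i (profit m y (real_of_ereal (call_time m s y \<omega>)) \<omega>) =
        discount m (hit m y x \<omega>) * game_payoff m s i x"
      unfolding ct using profit_hit[OF w x] by (cases "hit m y x \<omega> = \<infinity>") (auto simp: discount_def)
  qed
  also have "\<dots> = (y / x) powr beta m * game_payoff m s i x"
    using integral_discount_hit[OF y x] by simp
  finally show ?thesis .
qed

lemma playable_iff:
  fixes s :: "agent \<Rightarrow> strategy"
  assumes y: "0 < y"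
  defines "x \<equiv> max y (min (wait (s Agent1)) (wait (s Agent2)))"
  shows "playable m s y \<longleftrightarrow> ends s x"
proof -
  have x: "y \<le> x" by (simp add: x_def)
  have ct: "call_time m s y \<omega> = hit m y x \<omega>" if "\<omega> \<in> space (pricing m)" for \<omega>
    unfolding x_def hit_max[OF that] by (rule call_time_eq[OF that])
  \<comment> \<open>\<open>playable\<close> speaks of paths, so it yields \<open>ends\<close> at
    \<open>x\<close> only if some path gets there. If none did, the expected discount factor would
    be 0.\<close>
  have "\<exists>\<omega>\<in>space (pricing m). hit m y x \<omega> \<noteq> \<infinity>"
  proof (rule ccontr)
    assume "\<not> ?thesis"
    then have "(\<integral>\<omega>. discount m (hit m y x \<omega>) \<partial>pricing m) = (\<integral>\<omega>. 0 \<partial>pricing m)"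
      by (intro Bochner_Integration.integral_cong) (auto simp: discount_def)
    moreover have "(y / x) powr beta m \<noteq> 0" using y x by simp
    ultimately show False using integral_discount_hit[OF y x] by simp
  qed
  then show ?thesis
    unfolding playable_def using ct profit_hit[OF _ x] by auto
qed

lemma game_payoff_eq:
  assumes "0 < x" "follow (s (other i)) = YF m"
  shows "game_payoff m s i x = sole_at s x i * leader_value m x
    + sole_at s x (other i) * follower_payoff m (follow (s i)) x
    + both_at s x * regulated m i (leader_value m x) (follower_payoff m (follow (s i)) x) (joint_value m x)"
  unfolding game_payoff_def Let_def using assms by (simp add: leader_payoff_eq joint_payoff_eq)

end

section \<open>The regulated outcome against following\<close>

locale investment_game = market +
  fixes YL Y1 Y2 :: real
  assumes sets_eq: "sets (pricing m) = sets (physical m)"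
    and q_total: "qlead m Agent1 + qlead m Agent2 + qjoint m = 1"
    and q_pos: "0 < qlead m i" and qjoint_pos: "0 < qjoint m"
    and q_le: "qlead m Agent2 \<le> qlead m Agent1"
    and YL: "is_YL m YL"
    and Y1: "YL < Y1" "Y1 < YF m" "regulated_value m Agent1 Y1 = follower_value m Y1"
    and Y2: "YL < Y2" "Y2 < YF m" "regulated_value m Agent2 Y2 = follower_value m Y2"
begin

lemma q_sum: "qlead m i + qlead m (other i) + qjoint m = 1"
  using q_total by (cases i) auto

lemma YL_pos: "0 < YL" and YL_less: "YL < YF m"
  and leader_below: "0 < y \<Longrightarrow> y < YL \<Longrightarrow> leader_value m y < follower_value m y"
  and leader_YL: "leader_value m YL = follower_value m YL"
  and leader_above: "YL < y \<Longrightarrow> y < YF m \<Longrightarrow> follower_value m y < leader_value m y"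
  using YL unfolding is_YL_def by auto

primrec indiff :: "agent \<Rightarrow> real" where
  "indiff Agent1 = Y1"
| "indiff Agent2 = Y2"

lemma indiff: "YL < indiff i" "indiff i < YF m"
  "regulated_value m i (indiff i) = follower_value m (indiff i)"
  using Y1 Y2 by (cases i; simp)+

text \<open>The last factor is affine and decreasing in \<open>gap_ratio\<close>, so monotonicity of
  the latter turns the equality at \<open>indiff i\<close> into a single change of sign.\<close>

lemma regulated_gap:
  assumes "0 < y" "y < YF m"
  shows "regulated_value m i y - follower_value m y =
    (leader_value m y - joint_value m y) * (qlead m i - (qlead m i + qjoint m) * gap_ratio y)"
proof -
  let ?L = "leader_value m y" and ?F = "follower_value m y" and ?S = "joint_value m y"
  have qo: "qlead m (other i) = 1 - qlead m i - qjoint m" using q_sum[of i] by simp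
  have g: "?F - ?S = gap_ratio y * (?L - ?S)"
    using joint_less_leader[OF assms] by (simp add: gap_ratio_def)
  have "regulated_value m i y - ?F = qlead m i * (?L - ?S) - (qlead m i + qjoint m) * (?F - ?S)"
    unfolding regulated_value_def regulated_def qo by (simp add: algebra_simps)
  then show ?thesis unfolding g by (simp add: algebra_simps)
qed

lemma gap_ratio_indiff: "(qlead m i + qjoint m) * gap_ratio (indiff i) = qlead m i"
proof -
  have pos: "0 < indiff i" using indiff(1)[of i] YL_pos by simp
  have "(leader_value m (indiff i) - joint_value m (indiff i)) *
      (qlead m i - (qlead m i + qjoint m) * gap_ratio (indiff i)) = 0"
    using regulated_gap[OF pos indiff(2), of i] indiff(3)[of i] by simp
  then show ?thesis using joint_less_leader[OF pos indiff(2)] by simp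
qed

lemma gap_ratio_below:
  assumes "0 < y" "y < indiff i"
  shows "qlead m i < (qlead m i + qjoint m) * gap_ratio y"
proof -
  have "gap_ratio (indiff i) < gap_ratio y"
    by (rule gap_ratio_decreasing[OF assms indiff(2)])
  then have "(qlead m i + qjoint m) * gap_ratio (indiff i) < (qlead m i + qjoint m) * gap_ratio y"
    using q_pos[of i] qjoint_pos by (intro mult_strict_left_mono) auto
  then show ?thesis by (simp only: gap_ratio_indiff)
qed

lemma gap_ratio_above:
  assumes "indiff i \<le> y" "y < YF m"
  shows "(qlead m i + qjoint m) * gap_ratio y \<le> qlead m i"
proof -
  have "0 < indiff i" using indiff(1)[of i] YL_pos by simp
  then have "gap_ratio y \<le> gap_ratio (indiff i)"
    using gap_ratio_decreasing[of "indiff i" y] assms by (cases "y = indiff i") auto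
  then have "(qlead m i + qjoint m) * gap_ratio y \<le> (qlead m i + qjoint m) * gap_ratio (indiff i)"
    using q_pos[of i] qjoint_pos by (intro mult_left_mono) auto
  then show ?thesis by (simp only: gap_ratio_indiff)
qed

lemma regulated_below:
  assumes "0 < y" "y < indiff i"
  shows "regulated_value m i y \<le> follower_value m y"
proof -
  have "y < YF m" using assms indiff(2)[of i] by simp
  moreover have "(leader_value m y - joint_value m y) * (qlead m i - (qlead m i + qjoint m) * gap_ratio y) \<le> 0"
    using joint_less_leader[OF assms(1) \<open>y < YF m\<close>] gap_ratio_below[OF assms]
    by (intro mult_nonneg_nonpos) auto
  ultimately show ?thesis using regulated_gap[OF assms(1), of i] by simp
qed

lemma regulated_above:
  assumes "indiff i \<le> y"
  shows "follower_value m y \<le> regulated_value m i y"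
proof (cases "y < YF m")
  case True
  have y: "0 < y" using assms indiff(1)[of i] YL_pos by simp
  have "0 \<le> (leader_value m y - joint_value m y) * (qlead m i - (qlead m i + qjoint m) * gap_ratio y)"
    using joint_less_leader[OF y True] gap_ratio_above[OF assms True]
    by (intro mult_nonneg_nonneg) auto
  then show ?thesis using regulated_gap[OF y True, of i] by simp
next
  case False
  then have "regulated_value m i y = (qlead m i + qlead m (other i) + qjoint m) * joint_value m y"
    by (simp add: regulated_value_def regulated_def leader_value_high follower_value_high distrib_right)
  then show ?thesis using False q_sum[of i] by (simp add: follower_value_high)
qed

text \<open>Indifference reads \<open>q * (1 - g) = qjoint m * g\<close> with \<open>g\<close> the
  gap ratio. At \<open>Y2\<close> leading beats following, so \<open>1 - g\<close> is nonnegative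
  and the larger chance of election favours agent one.\<close>

lemma Y1_le_Y2: "Y1 \<le> Y2"
proof (rule ccontr)
  assume "\<not> Y1 \<le> Y2"
  then have "qlead m Agent1 < (qlead m Agent1 + qjoint m) * gap_ratio Y2"
    using gap_ratio_below[of Y2 Agent1] Y2 YL_pos by simp
  then have "qlead m Agent1 * (1 - gap_ratio Y2) < qjoint m * gap_ratio Y2"
    by (simp add: algebra_simps)
  moreover have "qlead m Agent2 * (1 - gap_ratio Y2) = qjoint m * gap_ratio Y2"
    using gap_ratio_indiff[of Agent2] by (simp add: algebra_simps)
  moreover have "0 \<le> 1 - gap_ratio Y2"
    using leader_above[OF Y2(1,2)] joint_less_leader[of Y2] Y2 YL_pos by (simp add: gap_ratio_def)
  then have "qlead m Agent2 * (1 - gap_ratio Y2) \<le> qlead m Agent1 * (1 - gap_ratio Y2)"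
    using q_le by (intro mult_right_mono)
  ultimately show False by simp
qed

section \<open>Indifference probabilities\<close>

lemma p0_YL: "p0 m YL = 0"
  by (simp add: p0_def leader_YL)

lemma p0_pos: "YL < y \<Longrightarrow> y < YF m \<Longrightarrow> 0 < p0 m y"
  using leader_above[of y] joint_less_leader[of y] YL_pos by (simp add: p0_def)

lemma p0_nonneg: "YL \<le> y \<Longrightarrow> y < YF m \<Longrightarrow> 0 \<le> p0 m y"
  using p0_pos[of y] p0_YL by (cases "y = YL") auto

lemma mixed_denom_pos: "0 \<le> p \<Longrightarrow> 0 < qlead m i * p + qjoint m"
  using q_pos[of i] qjoint_pos by (simp add: add_nonneg_pos)

lemma mixed_prob_YL: "mixed_prob m i YL = 0"
  by (simp add: mixed_prob_def p0_YL)

lemma mixed_prob_pos: "YL < y \<Longrightarrow> y < YF m \<Longrightarrow> 0 < mixed_prob m i y"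
  unfolding mixed_prob_def by (intro divide_pos_pos p0_pos mixed_denom_pos less_imp_le) auto

text \<open>The crossing of agents is intended: the probability of one stays below 1 exactly as long
  as the other strictly prefers following to regulation, both being the same inequality in
  \<open>gap_ratio\<close>.\<close>

lemma mixed_prob_less_1:
  assumes "YL \<le> y" "y < indiff i"
  shows "mixed_prob m (other i) y < 1"
proof -
  have y: "0 < y" "y < YF m" using assms indiff(2)[of i] YL_pos by auto
  have q: "1 - qlead m (other i) = qlead m i + qjoint m" using q_sum[of i] by simp
  have "(qlead m i + qjoint m) * (1 - gap_ratio y) < qjoint m"
    using gap_ratio_below[OF y(1) assms(2)] by (simp add: algebra_simps)
  then have "(1 - qlead m (other i)) * p0 m y < qjoint m"
    unfolding q p0_eq[OF y] .
  then have "p0 m y < qlead m (other i) * p0 m y + qjoint m" by (simp add: algebra_simps)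
  then show ?thesis
    unfolding mixed_prob_def using mixed_denom_pos[OF p0_nonneg[OF assms(1) y(2)], of "other i"]
    by simp
qed

text \<open>The expected loss of a leader from a clash offsets the advantage of leading over
  following.\<close>

lemma mixed_prob_indifferent:
  assumes "YL \<le> y" "y < YF m"
  shows "mixed_prob m (other i) y * (leader_value m y - regulated_value m i y) =
    leader_value m y - follower_value m y"
proof -
  let ?L = "leader_value m y" and ?F = "follower_value m y" and ?S = "joint_value m y"
  have y: "0 < y" using assms YL_pos by simp
  have LS: "?L - ?S \<noteq> 0" using joint_less_leader[OF y assms(2)] by simp
  have p: "?L - ?F = p0 m y * (?L - ?S)" using LS by (simp add: p0_def)
  have qi: "qlead m i = 1 - qlead m (other i) - qjoint m" using q_sum[of i] by simp
  have "?L - regulated_value m i y = qlead m (other i) * (?L - ?F) + qjoint m * (?L - ?S)"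
    unfolding regulated_value_def regulated_def qi by (simp add: algebra_simps)
  also have "\<dots> = (qlead m (other i) * p0 m y + qjoint m) * (?L - ?S)"
    unfolding p by (simp add: algebra_simps)
  finally have "?L - regulated_value m i y = (qlead m (other i) * p0 m y + qjoint m) * (?L - ?S)" .
  then show ?thesis
    unfolding p mixed_prob_def using mixed_denom_pos[OF p0_nonneg[OF assms], of "other i"] by simp
qed

section \<open>The equilibrium\<close>

text \<open>At \<open>YL\<close> the mixed probabilities are 0, so that call is resolved by the
  limit from above. Levels above \<open>YL\<close> matter because each starts its own
  sub-game.\<close>

primrec profile_exer :: "agent \<Rightarrow> real \<Rightarrow> real" where
  "profile_exer Agent1 = (\<lambda>y. if y < YL then 0 else if y < Y1 then mixed_prob m Agent1 y else 1)"
| "profile_exer Agent2 = (\<lambda>y. if y < YL then 0 else if y < Y1 then mixed_prob m Agent2 y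
     else if y < Y2 then 0 else 1)"

text \<open>The threshold \<open>YL\<close> also serves sub-games started above it: it is reached at
  time 0, so the game is called at once.\<close>

definition profile :: "agent \<Rightarrow> strategy" where
  "profile i = \<lparr>wait = YL, exer = profile_exer i, follow = YF m\<rparr>"

lemma profile_simps [simp]:
  "wait (profile i) = YL" "exer (profile i) = profile_exer i" "follow (profile i) = YF m"
  by (simp_all add: profile_def)

lemma exer_low: "y < YL \<Longrightarrow> profile_exer i y = 0"
  by (cases i) auto

lemma exer_mixed: "YL \<le> y \<Longrightarrow> y < Y1 \<Longrightarrow> profile_exer i y = mixed_prob m i y"
  by (cases i) auto

lemma exer_high: "Y2 \<le> y \<Longrightarrow> profile_exer i y = 1"
  using Y1_le_Y2 Y2(1) by (cases i) auto

lemma exer_middle: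
  assumes "Y1 \<le> y" "y < Y2"
  shows "profile_exer Agent1 y = 1" "profile_exer Agent2 y = 0"
  using assms Y1(1) by auto

declare profile_exer.simps [simp del]

lemma mixed_prob_range:
  assumes "YL < y" "y < Y1"
  shows "0 < mixed_prob m i y" "mixed_prob m i y < 1"
proof -
  show "0 < mixed_prob m i y" using mixed_prob_pos[of y i] assms Y1 by simp
  have "y < indiff (other i)" using assms Y1_le_Y2 by (cases i) auto
  then show "mixed_prob m i y < 1" using mixed_prob_less_1[of y "other i"] assms by simp
qed

lemma exer_bounds: "0 \<le> profile_exer i y" "profile_exer i y \<le> 1"
proof -
  consider "y < YL" | "y = YL" | "YL < y" "y < Y1" | "Y1 \<le> y" "y < Y2" | "Y2 \<le> y" by linarith
  then have "0 \<le> profile_exer i y \<and> profile_exer i y \<le> 1"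
  proof cases
    case 1 then show ?thesis by (simp add: exer_low)
  next
    case 2 then show ?thesis using Y1 by (simp add: exer_mixed mixed_prob_YL)
  next
    case 3 then show ?thesis using mixed_prob_range[of y i] by (simp add: exer_mixed)
  next
    case 4 then show ?thesis using exer_middle[of y] by (cases i) auto
  next
    case 5 then show ?thesis by (simp add: exer_high)
  qed
  then show "0 \<le> profile_exer i y" "profile_exer i y \<le> 1" by auto
qed

section \<open>Admissibility of the profile\<close>

lemma space_eq: "space (physical m) = space (pricing m)"
  using sets_eq_imp_space_eq[OF sets_eq] by simp

lemma profit_adapted:
  assumes "0 \<le> s" "s \<le> t"
  shows "profit m y s \<in> borel_measurable (generated_filtration \<Omega> (noise m) t)"
proof -
  have [measurable]: "noise m s \<in> borel_measurable (generated_filtration \<Omega> (noise m) t)"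
    by (rule measurable_generated_filtration[OF assms])
  show ?thesis unfolding profit_def[abs_def] by measurable
qed

text \<open>Admissibility refers to the filtration of \<open>noise m\<close> itself, so the
  running-maximum argument is applied to it anew; path continuity is inherited from the pricing
  measure's sample space.\<close>

lemma G_adapted: "adapted (generated_filtration (space (pricing m)) (noise m)) (G m y c)"
  unfolding adapted_def
proof (intro allI impI)
  fix t :: real assume t: "0 \<le> t"
  let ?N = "generated_filtration (space (pricing m)) (noise m) t"
  have "{\<omega>\<in>space ?N. \<exists>u\<in>{0..t}. c \<le> profit m y u \<omega>} \<in> sets ?N"
  proof (rule running_max_sets)
    show "continuous_on {0..t} (\<lambda>u. profit m y u \<omega>)" if "\<omega> \<in> space ?N" for \<omega>
      by (rule continuous_on_subset[OF profit_cont]) (use that in auto)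
  qed (use profit_adapted t in auto)
  moreover have "{\<omega>\<in>space ?N. \<exists>u\<in>{0..t}. c \<le> profit m y u \<omega>} =
      {\<omega>\<in>space ?N. hit m y c \<omega> \<le> ereal t}"
    using hit_le_iff[OF _ t] by auto
  ultimately have "{\<omega>\<in>space ?N. hit m y c \<omega> \<le> ereal t} \<in> sets ?N" by simp
  then show "G m y c t \<in> borel_measurable ?N"
    unfolding G_def[abs_def] by (intro measurable_If) auto
qed

lemma profile_exer_measurable: "profile_exer i \<in> borel_measurable borel"
proof -
  have [measurable]: "mixed_prob m j \<in> borel_measurable borel" for j
    unfolding mixed_prob_def[abs_def] p0_def[abs_def] leader_value_def[abs_def]
      follower_value_def[abs_def] joint_value_def[abs_def] by measurable
  show ?thesis by (cases i) (simp_all add: profile_exer.simps)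
qed

lemma profile_admissible: "admissible m (profile i)"
proof -
  have "adapted (generated_filtration (space (pricing m)) (noise m))
      (\<lambda>t \<omega>. profile_exer i (profit m y t \<omega>))" for y
    unfolding adapted_def
    by (intro allI impI measurable_compose[OF profit_adapted profile_exer_measurable]) auto
  then show ?thesis
    unfolding admissible_def Let_def space_eq
    using G_adapted exer_bounds YL_pos YF_pos by simp
qed

text \<open>Both probabilities vanish at \<open>YL\<close> like \<open>p0 m x / qjoint m\<close>,
  which makes the outcome a quotient 0/0. After cancelling one factor \<open>p0 m x\<close>, each
  sole outcome tends to \<open>qjoint m / (2 * qjoint m)\<close>, free of \<open>qlead\<close>,
  while a clash retains a factor \<open>p0 m x\<close> and disappears.\<close>

lemma mixed_prob_limits:
  "((\<lambda>x. sole_prob (\<lambda>j. profile_exer j x) i) \<longlongrightarrow> 1/2) (at_right YL)"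
  "((\<lambda>x. both_prob (\<lambda>j. profile_exer j x)) \<longlongrightarrow> 0) (at_right YL)"
proof -
  define A where "A j x = qlead m j * p0 m x + qjoint m" for j x
  \<comment> \<open>With \<open>A\<close> the denominators of the mixed probabilities,
    \<open>D\<close> is the probability that a round decides, stripped of the factor
    \<open>p0 m x / (A Agent1 x * A Agent2 x)\<close>.\<close>
  define D where "D x = A Agent1 x + A Agent2 x - p0 m x" for x
  have "(p0 m \<longlongrightarrow> p0 m YL) (at_right YL)"
    using isCont_p0[OF YL_pos YL_less] unfolding isCont_def by (rule filterlim_mono) (auto simp: at_le)
  then have p: "(p0 m \<longlongrightarrow> 0) (at_right YL)" by (simp add: p0_YL)
  have A: "(A j \<longlongrightarrow> qjoint m) (at_right YL)" for j
    unfolding A_def by (rule tendsto_eq_intros p refl | simp)+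
  have D: "(D \<longlongrightarrow> 2 * qjoint m) (at_right YL)"
    unfolding D_def by (rule tendsto_eq_intros p A refl | simp)+
  have eqs: "sole_prob (\<lambda>j. profile_exer j x) i = (A (other i) x - p0 m x) / D x"
    "both_prob (\<lambda>j. profile_exer j x) = p0 m x / D x" if x: "YL < x" "x < Y1" for x i
  proof -
    have pp: "0 < p0 m x" using p0_pos[of x] x Y1 by simp
    have Apos: "0 < A j x" for j unfolding A_def using mixed_denom_pos[of "p0 m x" j] pp by simp
    have P: "profile_exer j x = p0 m x / A j x" for j
      using x by (simp add: exer_mixed mixed_prob_def A_def)
    have mx: "0 < max (profile_exer Agent1 x) (profile_exer Agent2 x)"
      unfolding P using pp Apos by (simp add: less_max_iff_disj)
    have d: "1 - (1 - profile_exer Agent1 x) * (1 - profile_exer Agent2 x) =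
        p0 m x * D x / (A Agent1 x * A Agent2 x)"
      unfolding P D_def using Apos[of Agent1] Apos[of Agent2] by (simp add: field_simps)
    have n: "profile_exer i x * (1 - profile_exer (other i) x) =
        p0 m x * (A (other i) x - p0 m x) / (A Agent1 x * A Agent2 x)" for i
      unfolding P using Apos[of Agent1] Apos[of Agent2] by (cases i) (simp_all add: field_simps)
    have b: "profile_exer Agent1 x * profile_exer Agent2 x =
        p0 m x * p0 m x / (A Agent1 x * A Agent2 x)"
      unfolding P by simp
    have ne: "A Agent1 x * A Agent2 x \<noteq> 0" using Apos[of Agent1] Apos[of Agent2] by simp
    have c: "(p0 m x * a / (A Agent1 x * A Agent2 x)) / (p0 m x * D x / (A Agent1 x * A Agent2 x)) = a / D x" for a
      using ne pp by simp
    show "sole_prob (\<lambda>j. profile_exer j x) i = (A (other i) x - p0 m x) / D x"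
      using sole_prob_eq[of "\<lambda>j. profile_exer j x", OF exer_bounds mx, of i] unfolding d n c .
    show "both_prob (\<lambda>j. profile_exer j x) = p0 m x / D x"
      using both_prob_eq[of "\<lambda>j. profile_exer j x", OF exer_bounds mx] unfolding d b c .
  qed
  have ev: "\<forall>\<^sub>F x in at_right YL. YL < x \<and> x < Y1"
    unfolding eventually_at_right[OF Y1(1)] using Y1(1) by auto
  have "((\<lambda>x. (A (other i) x - p0 m x) / D x) \<longlongrightarrow> (qjoint m - 0) / (2 * qjoint m)) (at_right YL)"
    using qjoint_pos by (intro tendsto_divide tendsto_diff A p D) simp
  then have "((\<lambda>x. (A (other i) x - p0 m x) / D x) \<longlongrightarrow> 1/2) (at_right YL)"
    using qjoint_pos by simp
  then show "((\<lambda>x. sole_prob (\<lambda>j. profile_exer j x) i) \<longlongrightarrow> 1/2) (at_right YL)"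
    by (rule Lim_transform_eventually) (rule eventually_mono[OF ev], simp add: eqs)
  have "((\<lambda>x. p0 m x / D x) \<longlongrightarrow> 0 / (2 * qjoint m)) (at_right YL)"
    using qjoint_pos by (intro tendsto_divide p D) simp
  then have "((\<lambda>x. p0 m x / D x) \<longlongrightarrow> 0) (at_right YL)" by simp
  then show "((\<lambda>x. both_prob (\<lambda>j. profile_exer j x)) \<longlongrightarrow> 0) (at_right YL)"
    by (rule Lim_transform_eventually) (rule eventually_mono[OF ev], simp add: eqs)
qed

lemma profile_at_YL: "sole_at profile YL i = 1/2" "both_at profile YL = 0" "ends profile YL"
proof -
  have z: "profile_exer j YL = 0" for j using Y1 by (simp add: exer_mixed mixed_prob_YL)
  show "sole_at profile YL i = 1/2" "both_at profile YL = 0"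
    unfolding sole_at_def both_at_def
    using mixed_prob_limits[THEN tendsto_Lim[rotated]] by (simp_all add: z)
  have "(1/2::real) + 1/2 + 0 = 1" by simp
  then show "ends profile YL"
    unfolding ends_def profile_simps using mixed_prob_limits by blast
qed

lemma profile_max_pos:
  assumes "YL < y"
  shows "0 < max (profile_exer Agent1 y) (profile_exer Agent2 y)"
proof -
  consider "y < Y1" | "Y1 \<le> y" "y < Y2" | "Y2 \<le> y" by linarith
  then show ?thesis
  proof cases
    case 1
    then show ?thesis using mixed_prob_range[OF assms 1] assms by (simp add: exer_mixed less_max_iff_disj)
  next
    case 2 then show ?thesis using exer_middle[OF 2] by simp
  next
    case 3 then show ?thesis using exer_high[OF 3] by simp
  qed
qed

lemma profile_ends: "YL \<le> y \<Longrightarrow> ends profile y"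
  using profile_at_YL(3) profile_max_pos[of y] by (cases "y = YL") (auto simp: ends_def)

section \<open>Unilateral deviations\<close>

lemma deviation_exer_bounds:
  assumes "admissible m d"
  shows "0 \<le> exer ((profile(i := d)) j) y" "exer ((profile(i := d)) j) y \<le> 1"
  using assms exer_bounds by (auto simp: admissible_def)

text \<open>A deviation enters the pay-off at a level through the exercise probability there, and through
  the value obtained as follower, which \<open>YF m\<close> maximises.\<close>

lemma game_payoff_deviation:
  fixes i :: agent and d :: strategy and x :: real
  defines "p \<equiv> exer d x" and "r \<equiv> profile_exer (other i) x"
    and "f \<equiv> follower_payoff m (follow d) x"
  assumes d: "admissible m d" and x: "0 < x" and pos: "0 < max p r"
  shows "game_payoff m (profile(i := d)) i x * (1 - (1 - p) * (1 - r)) =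
    p * (1 - r) * leader_value m x + (1 - p) * r * f
      + p * r * regulated m i (leader_value m x) f (joint_value m x)"
proof -
  let ?s = "profile(i := d)"
  let ?e = "\<lambda>j. exer (?s j) x"
  have ei: "?e i = p" "?e (other i) = r" by (simp_all add: p_def r_def)
  have mx: "0 < max (?e Agent1) (?e Agent2)"
    using pos ei by (cases i) (auto simp: max.commute)
  have den: "(1 - ?e Agent1) * (1 - ?e Agent2) = (1 - p) * (1 - r)"
    using ei by (cases i) (auto simp: mult.commute)
  have prod: "?e Agent1 * ?e Agent2 = p * r"
    using ei by (cases i) (auto simp: mult.commute)
  have lt: "(1 - p) * (1 - r) < 1"
    using defer_less_1(2)[of ?e, OF deviation_exer_bounds[OF d] mx] unfolding den .
  note eqs = sole_prob_eq[of ?e, OF deviation_exer_bounds[OF d] mx, unfolded den]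
    both_prob_eq[of ?e, OF deviation_exer_bounds[OF d] mx, unfolded den prod]
  have at: "sole_at ?s x i = p * (1 - r) / (1 - (1 - p) * (1 - r))"
    "sole_at ?s x (other i) = r * (1 - p) / (1 - (1 - p) * (1 - r))"
    "both_at ?s x = p * r / (1 - (1 - p) * (1 - r))"
    unfolding sole_at_def both_at_def if_P[OF mx] eqs ei other_other by simp_all
  have "game_payoff m ?s i x = (p * (1 - r) * leader_value m x + (1 - p) * r * f
      + p * r * regulated m i (leader_value m x) f (joint_value m x)) / (1 - (1 - p) * (1 - r))"
    using game_payoff_eq[of x ?s i] x unfolding at f_def
    by (simp add: add_divide_distrib mult_ac)
  then show ?thesis using lt by simp
qed

lemma regulated_mono: "f \<le> follower_value m x \<Longrightarrow>
    regulated m i (leader_value m x) f (joint_value m x) \<le> regulated_value m i x"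
  unfolding regulated_value_def regulated_def using q_pos[of "other i"] by simp

text \<open>An opponent with positive exercise probability ends the game whatever the deviator does,
  so the probability that a round decides can be divided out; replacing the deviator's follower
  threshold by the optimal one only raises the pay-off.\<close>

lemma game_payoff_le:
  fixes i :: agent and d :: strategy and x V :: real
  defines "p \<equiv> exer d x" and "r \<equiv> profile_exer (other i) x"
  assumes d: "admissible m d" and x: "0 < x" and r: "0 < r"
    and V: "p * (1 - r) * leader_value m x + (1 - p) * r * follower_value m x
      + p * r * regulated_value m i x \<le> V * (1 - (1 - p) * (1 - r))"
  shows "game_payoff m (profile(i := d)) i x \<le> V"
proof -
  let ?f = "follower_payoff m (follow d) x"
  have p: "0 \<le> p" "p \<le> 1" using d by (auto simp: admissible_def p_def)
  have r1: "r \<le> 1" by (simp add: r_def exer_bounds)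
  have f: "?f \<le> follower_value m x" by (rule follower_payoff_le[OF x])
  have "(1 - p) * (1 - r) \<le> 1 * (1 - r)" using p r1 by (intro mult_right_mono) auto
  then have D: "0 < 1 - (1 - p) * (1 - r)" using r by simp
  have "game_payoff m (profile(i := d)) i x * (1 - (1 - p) * (1 - r)) =
      p * (1 - r) * leader_value m x + (1 - p) * r * ?f
      + p * r * regulated m i (leader_value m x) ?f (joint_value m x)"
    unfolding p_def r_def using r
    by (intro game_payoff_deviation d x) (simp add: r_def less_max_iff_disj)
  also have "\<dots> \<le> p * (1 - r) * leader_value m x + (1 - p) * r * follower_value m x
      + p * r * regulated_value m i x"
    using p r r1 f regulated_mono[OF f, of i] by (intro add_mono mult_left_mono) auto
  also note V
  finally show ?thesis using D by (rule mult_right_le_imp_le)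
qed

lemma game_payoff_profile:
  assumes x: "0 < x" and pos: "0 < max (profile_exer i x) (profile_exer (other i) x)"
    and V: "profile_exer i x * (1 - profile_exer (other i) x) * leader_value m x
      + (1 - profile_exer i x) * profile_exer (other i) x * follower_value m x
      + profile_exer i x * profile_exer (other i) x * regulated_value m i x
      = V * (1 - (1 - profile_exer i x) * (1 - profile_exer (other i) x))"
  shows "game_payoff m profile i x = V"
proof -
  have mx: "0 < max (profile_exer Agent1 x) (profile_exer Agent2 x)"
    using pos by (cases i) (auto simp: max.commute)
  have "(1 - profile_exer Agent1 x) * (1 - profile_exer Agent2 x) < 1"
    by (rule defer_less_1(2)[of "\<lambda>j. profile_exer j x", OF exer_bounds mx])
  then have "(1 - profile_exer i x) * (1 - profile_exer (other i) x) < 1"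
    by (cases i) (auto simp: mult.commute)
  moreover have "game_payoff m profile i x *
      (1 - (1 - profile_exer i x) * (1 - profile_exer (other i) x)) =
      V * (1 - (1 - profile_exer i x) * (1 - profile_exer (other i) x))"
    using game_payoff_deviation[OF profile_admissible x, of i i] pos V
    by (simp add: follower_payoff_YF[OF x] regulated_value_def)
  ultimately show ?thesis by simp
qed

text \<open>Valid for every \<open>p\<close>, so it gives the equilibrium value and bounds all
  deviations at once.\<close>

lemma mixed_identity:
  fixes i :: agent and p x :: real
  assumes "YL \<le> x" "x < YF m"
  defines "r \<equiv> mixed_prob m (other i) x"
  shows "p * (1 - r) * leader_value m x + (1 - p) * r * follower_value m x
      + p * r * regulated_value m i x = follower_value m x * (1 - (1 - p) * (1 - r))"
proof -
  have "p * (r * (leader_value m x - regulated_value m i x)) = p * (leader_value m x - follower_value m x)"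
    unfolding r_def mixed_prob_indifferent[OF assms(1,2)] ..
  then show ?thesis by (simp add: algebra_simps)
qed

lemma game_payoff_mixed:
  assumes "YL \<le> x" "x < Y1"
  shows "game_payoff m profile i x = follower_value m x"
proof (cases "x = YL")
  case True
  have "sole_at profile x i + sole_at profile x (other i) + both_at profile x = 1"
    unfolding True profile_at_YL(1,2) by simp
  then show ?thesis
    using game_payoff_eq[of x profile i] True profile_at_YL YL_pos
    by (simp add: follower_payoff_YF leader_YL)
next
  case False
  then have x: "YL < x" "x < Y1" "x < YF m" "0 < x" using assms Y1 YL_pos by auto
  show ?thesis
    by (rule game_payoff_profile[OF x(4)])
       (use mixed_prob_range[OF x(1,2)] mixed_identity[of x] x in
        \<open>auto simp: exer_mixed less_max_iff_disj\<close>)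
qed

lemma game_payoff_middle:
  assumes "Y1 \<le> x" "x < Y2"
  shows "game_payoff m profile Agent1 x = leader_value m x"
    "game_payoff m profile Agent2 x = follower_value m x"
  using game_payoff_profile[of x Agent1] game_payoff_profile[of x Agent2] exer_middle[OF assms]
    assms Y1 YL_pos by simp_all

lemma game_payoff_high:
  assumes "Y2 \<le> x"
  shows "game_payoff m profile i x = regulated_value m i x"
  using game_payoff_profile[of x i] exer_high[OF assms] assms Y2 YL_pos by simp

text \<open>If the opponent stays out on an interval to the right, only the deviator can end the
  game, whether at the level itself or through the limit from above.\<close>

lemma deviation_sole:
  assumes d: "admissible m d" and ends: "ends (profile(i := d)) x" and x: "0 < x" "x < x'"
    and z: "\<And>u. x \<le> u \<Longrightarrow> u < x' \<Longrightarrow> profile_exer (other i) u = 0"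
  shows "game_payoff m (profile(i := d)) i x = leader_value m x"
proof -
  note sm = sole_mover[of "profile(i := d)" x x' i, OF deviation_exer_bounds[OF d] ends _ x(2)]
  have "sole_at (profile(i := d)) x i = 1" "sole_at (profile(i := d)) x (other i) = 0"
    "both_at (profile(i := d)) x = 0"
    by (rule sm; simp add: z)+
  then show ?thesis using game_payoff_eq[of x "profile(i := d)" i] x by simp
qed

text \<open>At \<open>YL\<close> the opponent mixes just above, so the limit may charge all
  outcomes, but none pays more than following: leading is worth the same, and regulation is no
  better below \<open>indiff i\<close>. Strictly below \<open>YL\<close> the opponent is
  inactive.\<close>

lemma deviation_below:
  assumes d: "admissible m d" and ends: "ends (profile(i := d)) x" and x: "0 < x" "x \<le> YL"
  shows "game_payoff m (profile(i := d)) i x \<le> follower_value m x"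
proof (cases "x = YL")
  case True
  let ?s = "profile(i := d)"
  let ?F = "follower_value m x" and ?f = "follower_payoff m (follow d) x"
  have f: "?f \<le> ?F" by (rule follower_payoff_le[OF x(1)])
  note o = outcome_at[of ?s, OF deviation_exer_bounds[OF d] ends]
  have L: "leader_value m x = ?F" using True leader_YL by simp
  have "regulated m i (leader_value m x) ?f (joint_value m x) \<le> regulated_value m i x"
    by (rule regulated_mono[OF f])
  also have "\<dots> \<le> ?F" by (rule regulated_below) (use x True indiff(1)[of i] in auto)
  finally have R: "regulated m i (leader_value m x) ?f (joint_value m x) \<le> ?F" .
  have "game_payoff m ?s i x = sole_at ?s x i * ?F + sole_at ?s x (other i) * ?f
      + both_at ?s x * regulated m i (leader_value m x) ?f (joint_value m x)"
    using game_payoff_eq[of x ?s i] x L by simp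
  also have "\<dots> \<le> sole_at ?s x i * ?F + sole_at ?s x (other i) * ?F + both_at ?s x * ?F"
    using o(1)[of "other i"] o(2) f R by (intro add_mono mult_left_mono order_refl)
  also have "\<dots> = ?F" using o(3)[of i] by (simp only: distrib_right[symmetric] mult_1)
  finally show ?thesis .
next
  case False
  then have "x < YL" using x by simp
  then show ?thesis
    using deviation_sole[OF d ends x(1), of YL] leader_below[OF x(1)] exer_low by simp
qed

lemma deviation_above:
  assumes d: "admissible m d" and ends: "ends (profile(i := d)) x" and x: "YL \<le> x"
  shows "game_payoff m (profile(i := d)) i x \<le> game_payoff m profile i x"
proof -
  have x0: "0 < x" using x YL_pos by simp
  consider "x = YL" | "YL < x" "x < Y1" | "Y1 \<le> x" "x < Y2" | "Y2 \<le> x" using x by linarith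
  then show ?thesis
  proof cases
    case 1
    then show ?thesis
      using deviation_below[OF d ends x0] game_payoff_mixed[of x i] Y1 by simp
  next
    case 2
    then have xF: "x < YF m" using Y1 by simp
    have r: "profile_exer (other i) x = mixed_prob m (other i) x" using 2 by (simp add: exer_mixed)
    show ?thesis
      unfolding game_payoff_mixed[OF x 2(2)]
      by (rule game_payoff_le[OF d x0])
         (use mixed_prob_range[OF 2, of "other i"] mixed_identity[OF x xF, of "exer d x" i] in
          \<open>simp_all add: r\<close>)
  next
    \<comment> \<open>Agent one faces an opponent who defers up to \<open>Y2\<close>; as the game
      must end, any deviation leads. Agent two faces certain exercise and averages following with a
      regulated outcome that is no better below \<open>Y2\<close>.\<close>
    case 3
    show ?thesis
    proof (cases i)
      case Agent1
      then show ?thesis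
        using deviation_sole[OF d ends x0 3(2)] exer_middle 3 game_payoff_middle[OF 3] by simp
    next
      case Agent2
      have p: "0 \<le> exer d x" using d by (simp add: admissible_def)
      have "exer d x * regulated_value m Agent2 x \<le> exer d x * follower_value m x"
        using regulated_below[OF x0, of Agent2] 3 p by (intro mult_left_mono) auto
      then show ?thesis
        using game_payoff_le[OF d x0, of Agent2 "follower_value m x"] exer_middle[OF 3]
          game_payoff_middle[OF 3] Agent2 by (simp add: algebra_simps)
    qed
  next
    \<comment> \<open>The opponent exercises for sure, so a deviation averages following with
      regulation, and the latter is at least as good from \<open>indiff i\<close> on.\<close>
    case 4
    have p: "exer d x \<le> 1" using d by (simp add: admissible_def)
    have "indiff i \<le> x" using 4 Y1_le_Y2 by (cases i) auto
    then have "(1 - exer d x) * follower_value m x \<le> (1 - exer d x) * regulated_value m i x"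
      using regulated_above p by (intro mult_left_mono) auto
    then show ?thesis
      using game_payoff_le[OF d x0, of i "regulated_value m i x"] exer_high[OF 4]
        game_payoff_high[OF 4] by (simp add: algebra_simps)
  qed
qed

lemma payoff_profile:
  assumes "0 < y"
  shows "payoff m profile i y = (y / max y YL) powr beta m * game_payoff m profile i (max y YL)"
  using payoff_eq[OF assms, of profile i] by simp

lemma payoff_profile_above: "YL \<le> y \<Longrightarrow> payoff m profile i y = game_payoff m profile i y"
  using payoff_profile[of y i] YL_pos by (simp add: max_def)

lemma deviation_payoff:
  assumes y: "0 < y" and d: "admissible m d" and play: "playable m (profile(i := d)) y"
  shows "payoff m (profile(i := d)) i y \<le> payoff m profile i y"
proof -
  let ?s = "profile(i := d)"
  let ?x = "max y (min (wait (?s Agent1)) (wait (?s Agent2)))"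
  have x0: "0 < ?x" using y by simp
  have ends: "ends ?s ?x" using play playable_iff[OF y] by simp
  have pay: "payoff m ?s i y = (y / ?x) powr beta m * game_payoff m ?s i ?x"
    by (rule payoff_eq[OF y])
  \<comment> \<open>The opponent's threshold caps the call level: a deviator can bring the call
    forward but not delay it past \<open>YL\<close>.\<close>
  have min: "min (wait (?s Agent1)) (wait (?s Agent2)) \<le> YL" by (cases i) auto
  show ?thesis
  proof (cases "YL \<le> y")
    case True
    then have "?x = y" using min by simp
    then show ?thesis
      using pay deviation_above[OF d ends] True payoff_profile_above[OF True] y by simp
  next
    case False
    then have xL: "?x \<le> YL" using min by simp
    \<comment> \<open>A call between \<open>y\<close> and \<open>YL\<close> yields at most the
      follower's value there; discounted back it is the follower's value at \<open>y\<close>, which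
      is also what the profile pays.\<close>
    have "payoff m ?s i y \<le> (y / ?x) powr beta m * follower_value m ?x"
      unfolding pay using deviation_below[OF d ends x0 xL] by (intro mult_left_mono) auto
    also have "\<dots> = follower_value m y"
      using xL YL_less by (intro follower_value_scale y) auto
    also have "\<dots> = (y / YL) powr beta m * follower_value m YL"
      using False YL_less by (intro follower_value_scale[symmetric] y) auto
    also have "\<dots> = payoff m profile i y"
      using payoff_profile[OF y, of i] False game_payoff_mixed[of YL i] Y1 by (simp add: max_def)
    finally show ?thesis .
  qed
qed

lemma profile_playable: "0 < y \<Longrightarrow> playable m profile y"
  using playable_iff[of y profile] profile_ends[of "max y YL"] by simp

theorem profile_equilibrium: "markov_subgame_perfect m profile"
  unfolding markov_subgame_perfect_def
  using profile_admissible profile_playable deviation_payoff follower_payoff_le follower_payoff_YF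
  by simp

section \<open>Outcome probabilities of the profile\<close>

lemma profile_high_both: "Y2 \<le> y \<Longrightarrow> both_at profile y = 1"
  using both_prob_eq[of "\<lambda>j. profile_exer j y", OF exer_bounds] exer_high[of y]
  by (simp add: both_at_def)

lemma profile_middle_sole:
  assumes "Y1 \<le> y" "y < Y2"
  shows "sole_at profile y Agent1 = 1"
  using sole_prob_eq[of "\<lambda>j. profile_exer j y" Agent1, OF exer_bounds] exer_middle[OF assms]
  by (simp add: sole_at_def)

lemma profile_mixed_both:
  assumes "YL < y" "y < Y1"
  shows "0 < both_at profile y"
  using both_prob_eq[of "\<lambda>j. profile_exer j y", OF exer_bounds profile_max_pos[OF assms(1)]]
    profile_max_pos[OF assms(1)] mixed_prob_range[OF assms]
    defer_less_1(2)[of "\<lambda>j. profile_exer j y", OF exer_bounds profile_max_pos[OF assms(1)]] assms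
  by (simp add: both_at_def exer_mixed)

end

theorem theorem3p3:
  fixes m :: "'a model" and YL Y1 Y2 :: real
  assumes P: "brownian_motion (physical m) (noise m)"
    and Q: "sets (pricing m) = sets (physical m)"
      "brownian_motion (pricing m) (\<lambda>t \<omega>. noise m t \<omega> + price_of_risk m * t)"
    and params: "0 < eta m" "0 < sigma m" "0 < delta m" "0 < cost m" "0 < D2 m" "D2 m < D1 m"
    and regulator: "qlead m Agent1 + qlead m Agent2 + qjoint m = 1"
      "0 < Min {qlead m Agent1, qlead m Agent2, qjoint m}"
      "qlead m Agent2 \<le> qlead m Agent1"
    and YL: "is_YL m YL"
    and Y1: "YL < Y1" "Y1 < YF m" "regulated_value m Agent1 Y1 = follower_value m Y1"
    and Y2: "YL < Y2" "Y2 < YF m" "regulated_value m Agent2 Y2 = follower_value m Y2"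
  shows "\<exists>s :: agent \<Rightarrow> strategy.
    markov_subgame_perfect m s \<and>
    (\<comment> \<open>(i)\<close>
     \<forall>y. 0 < y \<and> y < YL \<longrightarrow>
       (\<forall>i. wait (s i) = YL \<and> exer (s i) y = 0) \<and>
       (\<forall>\<omega>\<in>space (pricing m). call_time m s y \<omega> = hit m y YL \<omega>)) \<and>
    (\<comment> \<open>(ii)\<close>
     (\<forall>i. exer (s i) YL = mixed_prob m i YL \<and> leader_prob m s YL i = 1/2 \<and>
          follow (s i) = YF m) \<and>
     both_at s YL = 0) \<and>
    (\<comment> \<open>(iii)\<close>
     \<forall>y. YL < y \<and> y < Y1 \<longrightarrow>
       (\<forall>i. exer (s i) y = mixed_prob m i y \<and> 0 < mixed_prob m i y \<and> mixed_prob m i y < 1) \<and>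
       payoff m s Agent1 y = payoff m s Agent2 y \<and>
       0 < both_at s y) \<and>
    (\<comment> \<open>(iv)\<close>
     \<forall>y. Y1 \<le> y \<and> y < Y2 \<longrightarrow>
       exer (s Agent1) y = 1 \<and> exer (s Agent2) y = 0 \<and>
       sole_at s y Agent1 = 1 \<and> follow (s Agent2) = YF m) \<and>
    (\<comment> \<open>(v)\<close>
     \<forall>y. Y2 \<le> y \<and> y < YF m \<longrightarrow>
       (\<forall>i. exer (s i) y = 1 \<and> follow (s i) = YF m) \<and> both_at s y = 1) \<and>
    (\<comment> \<open>(vi)\<close>
     \<forall>y. YF m \<le> y \<longrightarrow>
       (\<forall>i. exer (s i) y = 1 \<and>
            (\<forall>\<omega>\<in>space (pricing m). hit m y (follow (s i)) \<omega> = 0)) \<and>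
       both_at s y = 1)"
proof -
  have q: "0 < qlead m i" "0 < qjoint m" for i
    using regulator(2) by (cases i; simp)+
  interpret investment_game m YL Y1 Y2
    by unfold_locales (use assms q in simp_all)
  show ?thesis
  proof (rule exI[of _ profile], intro conjI allI impI ballI profile_equilibrium)
    fix y assume y: "0 < y \<and> y < YL"
    show "wait (profile i) = YL" "exer (profile i) y = 0" for i using y by (simp_all add: exer_low)
    show "call_time m profile y \<omega> = hit m y YL \<omega>" if "\<omega> \<in> space (pricing m)" for \<omega>
      using call_time_eq[OF that] by simp
  next
    show "exer (profile i) YL = mixed_prob m i YL" for i using Y1 by (simp add: exer_mixed)
    show "leader_prob m profile YL i = 1/2" for i by (simp add: leader_prob_def profile_at_YL)
    show "both_at profile YL = 0" by (rule profile_at_YL)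
  next
    fix y assume y: "YL < y \<and> y < Y1"
    show "exer (profile i) y = mixed_prob m i y" "0 < mixed_prob m i y" "mixed_prob m i y < 1" for i
      using y mixed_prob_range[of y i] by (simp_all add: exer_mixed)
    show "payoff m profile Agent1 y = payoff m profile Agent2 y"
      using y by (simp add: payoff_profile_above game_payoff_mixed)
    show "0 < both_at profile y" using y profile_mixed_both by simp
  next
    fix y assume y: "Y1 \<le> y \<and> y < Y2"
    show "exer (profile Agent1) y = 1" "exer (profile Agent2) y = 0" "sole_at profile y Agent1 = 1"
      using y exer_middle[of y] profile_middle_sole[of y] by simp_all
  next
    fix y assume y: "Y2 \<le> y \<and> y < YF m"
    show "exer (profile i) y = 1" "both_at profile y = 1" for i
      using y by (simp_all add: exer_high profile_high_both)
  next
    fix y assume "YF m \<le> y"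
    then have y: "YF m \<le> y" "Y2 \<le> y" using Y2 by auto
    show "exer (profile i) y = 1" "both_at profile y = 1" for i
      using y by (simp_all add: exer_high profile_high_both)
    show "hit m y (follow (profile i)) \<omega> = 0" if "\<omega> \<in> space (pricing m)" for i \<omega>
      using hit_eq_0[OF that y(1)] by simp
  qed simp_all
qed

end
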